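(* Let $A\in\mathbb{C}^{n\times n}$ have index $k$ and rank $r$, satisfy $\operatorname{rank}(A^{\sim}AA^{\sim})=\operatorname{rank}(A)$, and be written as $$A=U\begin{pmatrix}\Sigma K&\Sigma L\\ 0&0\end{pmatrix}U^{*},$$ where $U\in\mathbb{C}^{n\times n}$ is unitary, $\Sigma=\operatorname{diag}(\sigma_1,\dots,\sigma_r)$ is the diagonal matrix of the singular values $\sigma_i>0$ of $A$, and $K\in\mathbb{C}^{r\times r}$, $L\in\mathbb{C}^{r\times(n-r)}$ satisfy $KK^{*}+LL^{*}=I_r$. Let $G$ be the Minkowski metric matrix of order $n$, partitioned as $$G=U\begin{pmatrix}G_1&G_2\\ G_2^{*}&G_4\end{pmatrix}U^{*},\qquad G_1\in\mathbb{C}^{r\times r},\ G_2\in\mathbb{C}^{r\times(n-r)},\ G_4\in\mathbb{C}^{(n-r)\times(n-r)}.$$ Then: (1) $A^{D,\mathfrak{m}}=A^{D}P_{\mathcal{R}(A),\mathcal{N}(A^{\sim})}$; (2) for every positive integer $l$, $(A^{D,\mathfrak{m}})^{l}=(A^{D}A^{\mathfrak{m}})^{l/2}$ if $l$ is even, and $(A^{D,\mathfrak{m}})^{l}=A(A^{D}A^{\mathfrak{m}})^{(l+1)/2}$ if $l$ is odd; (3) $A^{D,\mathfrak{m}}=(A^{2}A^{\mathfrak{m}})^{D}$; (4) $((A^{D,\mathfrak{m}})^{D})^{D}=A^{D,\mathfrak{m}}$; (5) the following are equivalent: $AA^{D,\mathfrak{m}}=A^{D,\mathfrak{m}}A$;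 $A^{D,\mathfrak{m}}=A^{D}$; $\mathcal{N}(A^{\sim})\subseteq\mathcal{N}(A^{k})$; (6) $A^{D,\mathfrak{m}}=0$ if and only if $A$ is nilpotent; (7) $A^{D,\mathfrak{m}}=A$ if and only if $(\Sigma K)^{D}=\Sigma K$ and $L=KG_1^{-1}G_2$.
   Context: $\mathcal{R}(\cdot)$ and $\mathcal{N}(\cdot)$ denote range and null space. For subspaces with $\mathcal{S}\oplus\mathcal{T}=\mathbb{C}^n$, $P_{\mathcal{S},\mathcal{T}}$ is the projector onto $\mathcal{S}$ along $\mathcal{T}$. The index of $A\in\mathbb{C}^{n\times n}$ is the smallest nonnegative integer $k$ with $\operatorname{rank}(A^{k+1})=\operatorname{rank}(A^{k})$. The Minkowski metric matrix of order $n$ is $G=\operatorname{diag}(1,-I_{n-1})$. For $A\in\mathbb{C}^{n\times n}$, the Minkowski adjoint is $A^{\sim}=GA^{*}G$, where $A^*$ is the conjugate transpose. The Drazin inverse $A^{D}$ of a square matrix $A$ of index $k$ is the unique $X$ with $XAX=X$, $AX=XA$, $A^{k+1}X=A^{k}$. The Minkowski inverse $A^{\mathfrak{m}}$ is the unique matrix $X$ (if it exists) with $AXA=A$, $XAX=X$, $(AX)^{\sim}=AX$, $(XA)^{\sim}=XA$; it exists if and only if $\operatorname{rank}(A^{\sim}AA^{\sim})=\operatorname{rank}(A)$. When it exists, the $\mathfrak{m}$-DMP inverse of $A$ is $A^{D,\mathfrak{m}}=A^{D}AA^{\mathfrak{m}}$. Every $A\in\mathbb{C}^{n\times n}$ has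 a decomposition of the displayed form (the Hartwig–Spindelböck decomposition); under the rank hypothesis $G_1$ is nonsingular. *)

theory Defs
  imports
    "Jordan_Normal_Form.DL_Rank"
    "Jordan_Normal_Form.Matrix_Kernel"
    "Jordan_Normal_Form.Schur_Decomposition"
    "Jordan_Normal_Form.Gauss_Jordan_Elimination"
begin

abbreviation mat_rank :: "complex mat \<Rightarrow> nat" where
  "mat_rank A \<equiv> vec_space.rank (dim_row A) A"

text \<open>The range is the library's column space; by \<open>vec_space.col_space_eq\<close> it is
  \<open>{A *\<^sub>v x | x. x \<in> carrier_vec (dim_col A)}\<close>.\<close>
abbreviation mat_range :: "complex mat \<Rightarrow> complex vec set" where
  "mat_range A \<equiv> vec_space.col_space (dim_row A) A"

definition unitary_mat :: "nat \<Rightarrow> complex mat \<Rightarrow> bool" where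
  "unitary_mat n U \<longleftrightarrow> U \<in> carrier_mat n n \<and>
     mat_adjoint U * U = 1\<^sub>m n \<and> U * mat_adjoint U = 1\<^sub>m n"

definition nilpotent_mat :: "complex mat \<Rightarrow> bool" where
  "nilpotent_mat A \<longleftrightarrow> (\<exists>m. A ^\<^sub>m m = 0\<^sub>m (dim_row A) (dim_row A))"

text \<open>With multiplicity, and including the zero singular values.  The roots below are
  nonnegative reals, being the eigenvalues of \<open>A\<^sup>* A\<close>, so \<open>Re\<close> loses nothing.\<close>
definition singular_values :: "complex mat \<Rightarrow> real multiset" where
  "singular_values A =
     image_mset (\<lambda>z. sqrt (Re z)) (proots (char_poly (mat_adjoint A * A)))"

definition direct_sum_vec :: "nat \<Rightarrow> complex vec set \<Rightarrow> complex vec set \<Rightarrow> bool" where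
  "direct_sum_vec n S T \<longleftrightarrow>
     VectorSpace.subspace class_ring S (module_vec TYPE(complex) n) \<and>
     VectorSpace.subspace class_ring T (module_vec TYPE(complex) n) \<and>
     S \<inter> T = {0\<^sub>v n} \<and>
     (\<forall>v \<in> carrier_vec n. \<exists>s \<in> S. \<exists>t \<in> T. v = s + t)"

text \<open>The projector onto \<open>S\<close> along \<open>T\<close>; meaningful when \<open>direct_sum_vec n S T\<close>.\<close>
definition projector :: "nat \<Rightarrow> complex vec set \<Rightarrow> complex vec set \<Rightarrow> complex mat" where
  "projector n S T = (THE P. P \<in> carrier_mat n n \<and>
     (\<forall>s \<in> S. P *\<^sub>v s = s) \<and> (\<forall>t \<in> T. P *\<^sub>v t = 0\<^sub>v n))"

definition mat_index :: "complex mat \<Rightarrow> nat" where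
  "mat_index A = (LEAST k. mat_rank (A ^\<^sub>m (k + 1)) = mat_rank (A ^\<^sub>m k))"

definition is_drazin_inverse :: "complex mat \<Rightarrow> complex mat \<Rightarrow> bool" where
  "is_drazin_inverse A X \<longleftrightarrow> X \<in> carrier_mat (dim_row A) (dim_row A) \<and>
     X * A * X = X \<and> A * X = X * A \<and>
     A ^\<^sub>m (mat_index A + 1) * X = A ^\<^sub>m (mat_index A)"

definition drazin_inverse :: "complex mat \<Rightarrow> complex mat" where
  "drazin_inverse A = (THE X. is_drazin_inverse A X)"

definition minkowski_metric :: "nat \<Rightarrow> complex mat" where
  "minkowski_metric n = mat_diag n (\<lambda>i. if i = 0 then 1 else - 1)"

text \<open>For square matrices.\<close>
definition minkowski_adjoint :: "complex mat \<Rightarrow> complex mat" where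
  "minkowski_adjoint A =
     minkowski_metric (dim_row A) * mat_adjoint A * minkowski_metric (dim_row A)"

definition is_minkowski_inverse :: "complex mat \<Rightarrow> complex mat \<Rightarrow> bool" where
  "is_minkowski_inverse A X \<longleftrightarrow> X \<in> carrier_mat (dim_row A) (dim_row A) \<and>
     A * X * A = A \<and> X * A * X = X \<and>
     minkowski_adjoint (A * X) = A * X \<and> minkowski_adjoint (X * A) = X * A"

definition minkowski_inverse :: "complex mat \<Rightarrow> complex mat" where
  "minkowski_inverse A = (THE X. is_minkowski_inverse A X)"

definition m_dmp_inverse :: "complex mat \<Rightarrow> complex mat" where
  "m_dmp_inverse A = drazin_inverse A * A * minkowski_inverse A"

end

theory Submission
  imports Defs
begin

text \<open>
Write \<open>D\<close> for the Drazin inverse and \<open>M\<close> for the Minkowski inverse of \<open>A\<close>, so that the m-DMP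
inverse is \<open>X = D A M\<close>.  Apart from the last equivalence, everything follows from the defining
equations of \<open>D\<close> and \<open>M\<close>.  Since \<open>D = A D\<^sup>2 = D\<^sup>2 A\<close>, the equation \<open>A M A = A\<close> gives the two
absorption laws \<open>A M D = D\<close> and \<open>D M A = D\<close>; with \<open>A D = D A\<close> they reduce every word in
\<open>A, D, M\<close> that occurs below to a normal form.  In particular \<open>X\<^sup>2 = D M\<close>, and \<open>X\<close> satisfies the
equations of the Drazin inverse of \<open>A\<^sup>2 M\<close>, whence its double Drazin inverse is \<open>X\<close> again.
The matrix \<open>A M\<close> is the projector onto the range of \<open>A\<close> along the kernel of the Minkowski adjoint
of \<open>A\<close>, because the symmetry of \<open>A M\<close> makes \<open>A M\<close> and that adjoint left multiples of each other.
So \<open>X = D\<close> says that \<open>D\<close> kills this kernel, and \<open>D\<close> has the same kernel as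
\<open>A\<close> to the power of its index; and \<open>X = 0\<close> says \<open>D = X A D = 0\<close>, that is, that \<open>A\<close> is nilpotent.

What has to be supplied is the existence of the two inverses.  The range of the powers of \<open>A\<close>
becomes stationary at the index, and equality of ranks turns this into a factorization
\<open>A\<^sup>k = A\<^sup>k\<^sup>+\<^sup>1 W\<close> (lemma \<open>mat_rank_mult_le\<close>); applied to \<open>A\<close> and to its transpose this yields
\<open>D\<close> by an explicit formula (lemma \<open>ex_drazin_inverse\<close>).
The Hartwig--Spindelboeck form provides a full rank factorization \<open>A = F H\<close>, where \<open>F\<close> consists of
the first \<open>r\<close> columns of the unitary matrix \<open>U\<close>.  With the Minkowski metric \<open>G\<close>, the Minkowski
adjoint of \<open>A\<close> is \<open>G H\<^sup>* F\<^sup>* G\<close>, and the product in the rank hypothesis is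
\<open>G H\<^sup>* (F\<^sup>* G F) (H G H\<^sup>*) F\<^sup>* G\<close>.  As its rank is \<open>r\<close>, both \<open>r\<close>-by-\<open>r\<close> middle factors are
invertible; the first of them is \<open>G\<^sub>1\<close>.  The Minkowski inverse is then
\<open>G H\<^sup>* (H G H\<^sup>*)\<^sup>-\<^sup>1 G\<^sub>1\<^sup>-\<^sup>1 F\<^sup>* G\<close>
(lemma \<open>minkowski_inverse_of_full_rank_factorization\<close>).

For the last equivalence let \<open>T = H F = \<Sigma> K\<close>.  Cline's formula \<open>(F H)\<^sup>D = F (T\<^sup>D)\<^sup>2 H\<close>
(lemma \<open>drazin_inverse_mult_swap\<close>) gives \<open>X = F T\<^sup>D G\<^sub>1\<^sup>-\<^sup>1 F\<^sup>* G\<close>, whose nonzero block row in the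
basis \<open>U\<close> is \<open>(T\<^sup>D, T\<^sup>D G\<^sub>1\<^sup>-\<^sup>1 G\<^sub>2)\<close>.  Comparison with the block row \<open>(\<Sigma> K, \<Sigma> L)\<close> of \<open>A\<close>, and
cancellation of the invertible \<open>\<Sigma>\<close>, finish the proof.
\<close>

section \<open>Ranges, kernels, ranks and projectors\<close>

text \<open>
A basis of a subspace of full dimension is independent of maximal size in the whole space, hence
spans it.
\<close>
context vectorspace begin
lemma subspace_eq_carrier_of_dim_eq:
  assumes "VectorSpace.subspace K X V" "fin_dim" "vectorspace.fin_dim K (vs X)"
    and "vectorspace.dim K (vs X) = dim"
  shows "X = carrier V"
proof -
  have vX: "vectorspace K (vs X)" using assms(1) subspace_is_vs by auto
  then obtain b where b: "vectorspace.basis K (vs X) b"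
    using vectorspace.finite_basis_exists assms(3) by blast
  have sub: "submodule K X V" using assms(1) VectorSpace.subspace_def by blast
  then have XV: "X \<subseteq> carrier V" by (auto simp: submodule_def)
  have bX: "b \<subseteq> X" and li: "LinearCombinations.module.lin_indpt K (vs X) b"
    and gen: "LinearCombinations.module.gen_set K (vs X) b"
    using b vectorspace.basis_def[OF vX] by auto
  have li': "lin_indpt b" using module.span_li_not_depend(2)[OF bX sub] li by blast
  have fb: "finite b"
    using li_le_dim(1)[OF \<open>fin_dim\<close> _ li'] bX XV by auto
  have "card b = dim" using vectorspace.dim_basis[OF vX fb b] assms(4) by simp
  then have "basis b" using dim_li_is_basis[OF \<open>fin_dim\<close> fb _ li'] bX XV by auto
  then have "span b = carrier V" by (simp add: basis_def)
  moreover have "span b = X" using module.span_li_not_depend(1)[OF bX sub] gen by simp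
  ultimately show ?thesis by simp
qed
end

lemma mat_range_eq:
  assumes "A \<in> carrier_mat m p"
  shows "mat_range A = (\<lambda>x. A *\<^sub>v x) ` carrier_vec p"
proof -
  interpret vec_space "TYPE(complex)" m .
  show ?thesis using col_space_eq[OF assms] assms by auto
qed

lemma mat_range_subspace:
  assumes "A \<in> carrier_mat m p"
  shows "VectorSpace.subspace class_ring (mat_range A) (module_vec TYPE(complex) m)"
proof -
  interpret vec_space "TYPE(complex)" m .
  have "set (cols A) \<subseteq> carrier V" using assms cols_dim by fastforce
  then show ?thesis using assms span_is_subspace by (auto simp: col_space_def)
qed
lemma mat_kernel_subspace:
  fixes A :: "complex mat"
  assumes "A \<in> carrier_mat m p"
  shows "VectorSpace.subspace class_ring (mat_kernel A) (module_vec TYPE(complex) p)"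
proof -
  interpret kernel m p A by (unfold_locales) (rule assms)
  have "submodule class_ring (mat_kernel A) NC.V"
    by unfold_locales
      (insert A mult_add_distrib_mat_vec[OF A] mult_mat_vec[OF A] mat_kernel[OF A], auto simp: class_ring_simps)
  then show ?thesis unfolding VectorSpace.subspace_def using NC.vectorspace_axioms by auto
qed

text \<open>
The range of \<open>A B\<close> lies in the range of \<open>A\<close>.  If the dimensions agree, the ranges agree, so
every column of \<open>A\<close> is a combination of columns of \<open>A B\<close>; the coefficients form \<open>W\<close>.
This is the only way in which ranks enter the other proofs.
\<close>
lemma mat_rank_mult_le:
  assumes A: "A \<in> carrier_mat m p" and B: "B \<in> carrier_mat p q"
  shows "mat_rank (A * B) \<le> mat_rank A"
    and "mat_rank (A * B) = mat_rank A \<Longrightarrow> \<exists>W \<in> carrier_mat q p. A * B * W = A"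
proof -
  interpret vec_space "TYPE(complex)" m .
  have AB: "A * B \<in> carrier_mat m q" using A B by simp
  have dims: "dim_row (A * B) = m" "dim_row A = m" using A by auto
  let ?W = "span (set (cols A))" and ?X = "span (set (cols (A * B)))"
  have sW: "VectorSpace.subspace class_ring ?W V" and sX: "VectorSpace.subspace class_ring ?X V"
    using mat_range_subspace[OF A] mat_range_subspace[OF AB] dims by (auto simp: col_space_def)
  have XW: "?X \<subseteq> ?W"
  proof -
    have "A * B *\<^sub>v x = A *\<^sub>v (B *\<^sub>v x)" if "x \<in> carrier_vec q" for x
      using assoc_mult_mat_vec[OF A B that] .
    then have "mat_range (A * B) \<subseteq> mat_range A"
      unfolding mat_range_eq[OF AB] mat_range_eq[OF A] using B by auto
    then show ?thesis using dims by (auto simp: col_space_def)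
  qed
  have vW: "vectorspace class_ring (vs ?W)" using sW subspace_is_vs by auto
  have X_in_W: "VectorSpace.subspace class_ring ?X (vs ?W)" using nested_subspaces[OF sW sX XW] .
  have fW: "vectorspace.fin_dim class_ring (vs ?W)" and fX: "vectorspace.fin_dim class_ring (vs ?X)"
    using fin_dim_span_cols[OF A] fin_dim_span_cols[OF AB] by auto
  have vsX: "vs ?W\<lparr>carrier := ?X\<rparr> = vs ?X" by simp
  show "mat_rank (A * B) \<le> mat_rank A"
    using vectorspace.subspace_dim[OF vW X_in_W fW] fX unfolding dims rank_def by simp
  assume "mat_rank (A * B) = mat_rank A"
  then have "?X = ?W"
    using vectorspace.subspace_eq_carrier_of_dim_eq[OF vW X_in_W fW] fX
    unfolding dims rank_def by simp
  then have eq: "mat_range (A * B) = mat_range A" using dims by (simp add: col_space_def)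
  have ex: "\<exists>w \<in> carrier_vec q. A * B *\<^sub>v w = col A j" if "j < p" for j
  proof -
    have "col A j = A *\<^sub>v unit_vec p j" using col_mult2[OF A one_carrier_mat that] A that by simp
    then have "col A j \<in> mat_range A" unfolding mat_range_eq[OF A] by auto
    then show ?thesis unfolding eq[symmetric] mat_range_eq[OF AB] by auto
  qed
  define w where "w j = (SOME w. w \<in> carrier_vec q \<and> A * B *\<^sub>v w = col A j)" for j
  have w: "w j \<in> carrier_vec q" "A * B *\<^sub>v w j = col A j" if "j < p" for j
    using someI_ex[OF ex[OF that, unfolded Bex_def]] by (auto simp: w_def)
  define W where "W = mat_of_cols q (map w [0..<p])"
  have W: "W \<in> carrier_mat q p" by (simp add: W_def carrier_matI)
  have "A * B * W = A"
  proof (rule mat_col_eqI)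
    fix j assume "j < dim_col A"
    then have j: "j < p" using A by simp
    then have "col W j = w j" using w(1) by (simp add: W_def)
    then show "col (A * B * W) j = col A j" using col_mult2[OF AB W j] w(2)[OF j] by simp
  qed (use A W in auto)
  with W show "\<exists>W \<in> carrier_mat q p. A * B * W = A" by blast
qed

lemma mat_eq_if_mult_vec_eq:
  fixes P :: "'a :: semiring_1 mat"
  assumes P: "P \<in> carrier_mat m p" and Q: "Q \<in> carrier_mat m p"
    and eq: "\<And>v. v \<in> carrier_vec p \<Longrightarrow> P *\<^sub>v v = Q *\<^sub>v v"
  shows "P = Q"
proof (rule mat_col_eqI)
  fix j assume "j < dim_col Q"
  then have j: "j < p" using Q by simp
  have "col P j = P *\<^sub>v unit_vec p j" "col Q j = Q *\<^sub>v unit_vec p j"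
    using col_mult2[OF P one_carrier_mat j] col_mult2[OF Q one_carrier_mat j] P Q j by simp_all
  then show "col P j = col Q j" using eq by simp
qed (use P Q in auto)

lemma projector_eqI:
  assumes ds: "direct_sum_vec n S T" and sub: "S \<subseteq> carrier_vec n" "T \<subseteq> carrier_vec n"
    and P: "P \<in> carrier_mat n n" "\<forall>s \<in> S. P *\<^sub>v s = s" "\<forall>t \<in> T. P *\<^sub>v t = 0\<^sub>v n"
  shows "projector n S T = P"
  unfolding projector_def
proof (rule the_equality)
  fix Q assume Q: "Q \<in> carrier_mat n n \<and> (\<forall>s \<in> S. Q *\<^sub>v s = s) \<and> (\<forall>t \<in> T. Q *\<^sub>v t = 0\<^sub>v n)"
  show "Q = P"
  proof (rule mat_eq_if_mult_vec_eq)
    fix v :: "complex vec" assume "v \<in> carrier_vec n"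
    then obtain s t where "s \<in> S" "t \<in> T" "v = s + t" using ds unfolding direct_sum_vec_def by blast
    then show "Q *\<^sub>v v = P *\<^sub>v v"
      using P Q sub mult_add_distrib_mat_vec[of P n n s t] mult_add_distrib_mat_vec[of Q n n s t]
      by (auto simp: subset_iff)
  qed (use P Q in auto)
qed (use P in auto)

section \<open>The Drazin inverse\<close>

text \<open>
Products are normalised by associating to the right.  An equation for a product of two factors
must then also be available in front of a further factor.
\<close>
lemma mult_mat_extend:
  assumes "A * B = C" "A \<in> carrier_mat a b" "B \<in> carrier_mat b c" "Z \<in> carrier_mat c d"
  shows "A * (B * Z) = C * Z"
  using assms assoc_mult_mat by metis

lemma pow_mat_add:
  fixes A :: "'a :: semiring_1 mat"
  assumes "A \<in> carrier_mat n n"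
  shows "A ^\<^sub>m (i + j) = A ^\<^sub>m i * A ^\<^sub>m j"
proof (induction j)
  case (Suc j)
  then show ?case
    using assms assoc_mult_mat[of "A ^\<^sub>m i" n n "A ^\<^sub>m j" n A n] by simp
qed (use assms in simp)

lemma pow_mat_Suc_left:
  fixes A :: "'a :: semiring_1 mat"
  assumes "A \<in> carrier_mat n n"
  shows "A ^\<^sub>m Suc k = A * A ^\<^sub>m k"
  using pow_mat_add[OF assms, of 1 k] assms by simp

lemma pow_mat_commute:
  fixes A X :: "'a :: semiring_1 mat"
  assumes A: "A \<in> carrier_mat n n" and X: "X \<in> carrier_mat n n" and comm: "A * X = X * A"
  shows "A ^\<^sub>m i * X = X * A ^\<^sub>m i"
proof (induction i)
  case (Suc i)
  note sq = assoc_mult_mat[of _ n n _ n _ n] mult_carrier_mat[of _ n n _ n]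
  have "A ^\<^sub>m Suc i * X = A ^\<^sub>m i * (X * A)" using A X comm by (simp add: sq)
  also have "\<dots> = A ^\<^sub>m i * X * A" using A X by (simp add: sq)
  also have "\<dots> = X * A ^\<^sub>m Suc i" using A X Suc by (simp add: sq)
  finally show ?case .
qed (use A X in simp)

lemma transpose_pow_mat:
  fixes A :: "'a :: comm_semiring_1 mat"
  assumes "A \<in> carrier_mat n n"
  shows "transpose_mat (A ^\<^sub>m k) = transpose_mat A ^\<^sub>m k"
proof (induction k)
  case (Suc k)
  have "transpose_mat (A ^\<^sub>m Suc k) = transpose_mat A * transpose_mat (A ^\<^sub>m k)"
    using transpose_mult[of "A ^\<^sub>m k" n n A n] assms by simp
  also have "\<dots> = transpose_mat A ^\<^sub>m Suc k"
    using pow_mat_Suc_left[of "transpose_mat A" n k] assms Suc by simp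
  finally show ?case .
qed (use assms in simp)

text \<open>
The least number in the definition of the index exists because the ranks of the powers cannot
decrease strictly for ever.
\<close>
lemma mat_index_rank:
  assumes A: "A \<in> carrier_mat n n"
  shows "mat_rank (A ^\<^sub>m (mat_index A + 1)) = mat_rank (A ^\<^sub>m mat_index A)"
proof -
  have "\<exists>k. mat_rank (A ^\<^sub>m (k + 1)) = mat_rank (A ^\<^sub>m k)"
  proof (rule ccontr)
    assume "\<nexists>k. mat_rank (A ^\<^sub>m (k + 1)) = mat_rank (A ^\<^sub>m k)"
    moreover have "mat_rank (A ^\<^sub>m (k + 1)) \<le> mat_rank (A ^\<^sub>m k)" for k
      using mat_rank_mult_le(1)[of "A ^\<^sub>m k" n n A n] A by simp
    ultimately have less: "mat_rank (A ^\<^sub>m (k + 1)) < mat_rank (A ^\<^sub>m k)" for k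
      using le_neq_implies_less by blast
    have "mat_rank (A ^\<^sub>m k) + k \<le> mat_rank (A ^\<^sub>m 0)" for k
    proof (induction k)
      case (Suc k)
      then show ?case using less[of k] by simp
    qed simp
    from this[of "Suc (mat_rank (A ^\<^sub>m 0))"] show False by simp
  qed
  then show ?thesis unfolding mat_index_def by (rule LeastI_ex)
qed

text \<open>
From the index on, the ranges of the powers are stationary: \<open>A\<^sup>k = A\<^sup>k\<^sup>+\<^sup>1 Z\<close>, and substituting this
into itself raises the exponent on the right arbitrarily.
\<close>
lemma mat_index_pow_eq:
  assumes A: "A \<in> carrier_mat n n"
  shows "\<exists>W \<in> carrier_mat n n. A ^\<^sub>m mat_index A = A ^\<^sub>m (mat_index A + m) * W"
proof -
  define k where "k = mat_index A"
  obtain Z where Z: "Z \<in> carrier_mat n n" and AZ: "A ^\<^sub>m k * A * Z = A ^\<^sub>m k"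
    using mat_rank_mult_le(2)[of "A ^\<^sub>m k" n n A n] mat_index_rank[OF A] A by (auto simp: k_def)
  have "\<exists>W \<in> carrier_mat n n. A ^\<^sub>m k = A ^\<^sub>m (k + m) * W"
  proof (induction m)
    case 0
    have "A ^\<^sub>m k = A ^\<^sub>m (k + 0) * 1\<^sub>m n" using A by simp
    then show ?case using one_carrier_mat by blast
  next
    case (Suc m)
    then obtain W where W: "W \<in> carrier_mat n n" and k: "A ^\<^sub>m k = A ^\<^sub>m (k + m) * W" by blast
    have "A ^\<^sub>m (k + m) = A ^\<^sub>m m * A ^\<^sub>m k"
      using pow_mat_add[OF A, of m k] by (simp add: add.commute)
    also have "\<dots> = A ^\<^sub>m m * (A ^\<^sub>m k * A * Z)" by (simp only: AZ)
    also have "\<dots> = A ^\<^sub>m m * A ^\<^sub>m k * A * Z"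
      using A Z by (simp add: assoc_mult_mat[of _ n n _ n _ n] mult_carrier_mat[of _ n n _ n])
    also have "\<dots> = A ^\<^sub>m (k + Suc m) * Z"
      using pow_mat_add[OF A, of m k] by (simp add: add.commute)
    finally have step: "A ^\<^sub>m (k + m) = A ^\<^sub>m (k + Suc m) * Z" .
    have "A ^\<^sub>m k = A ^\<^sub>m (k + Suc m) * Z * W" by (rule k[unfolded step])
    also have "\<dots> = A ^\<^sub>m (k + Suc m) * (Z * W)"
      by (rule assoc_mult_mat[of _ n n _ n _ n]) (use A Z W in auto)
    finally have "A ^\<^sub>m k = A ^\<^sub>m (k + Suc m) * (Z * W)" .
    then show ?case using Z W by (meson mult_carrier_mat)
  qed
  then show ?thesis by (simp add: k_def)
qed

lemma mat_index_pow_eq_ge: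
  assumes A: "A \<in> carrier_mat n n" and "mat_index A \<le> j"
  shows "\<exists>W \<in> carrier_mat n n. A ^\<^sub>m j = A ^\<^sub>m (j + m) * W"
proof -
  obtain i where j: "j = i + mat_index A" using assms(2) by (metis le_add_diff_inverse2)
  obtain W where W: "W \<in> carrier_mat n n" "A ^\<^sub>m mat_index A = A ^\<^sub>m (mat_index A + m) * W"
    using mat_index_pow_eq[OF A] by blast
  have "A ^\<^sub>m j = A ^\<^sub>m i * (A ^\<^sub>m (mat_index A + m) * W)"
    unfolding j pow_mat_add[OF A, of i] using W(2) by simp
  also have "\<dots> = A ^\<^sub>m i * A ^\<^sub>m (mat_index A + m) * W"
    using A W(1) by (simp add: assoc_mult_mat[of _ n n _ n _ n])
  also have "\<dots> = A ^\<^sub>m (j + m) * W"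
    using pow_mat_add[OF A, of i "mat_index A + m"] by (simp add: j ac_simps)
  finally show ?thesis using W(1) by blast
qed

text \<open>
The exponent in the third equation may be any number instead of the index, which spares the
computation of the index of a matrix when a candidate inverse is verified.  To descend from
\<open>j\<close> to the index \<open>k\<close>, write \<open>A\<^sup>k = A\<^sup>j A\<^sup>k W\<close> and let \<open>X A\<close> be absorbed by \<open>A\<^sup>j\<close>.
\<close>
lemma is_drazin_inverse_iff:
  assumes A: "A \<in> carrier_mat n n"
  shows "is_drazin_inverse A X \<longleftrightarrow>
    X \<in> carrier_mat n n \<and> X * A * X = X \<and> A * X = X * A \<and> (\<exists>j. A ^\<^sub>m (j + 1) * X = A ^\<^sub>m j)"
    (is "_ \<longleftrightarrow> ?R")
proof
  assume "is_drazin_inverse A X"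
  then show ?R using A unfolding is_drazin_inverse_def by auto
next
  assume ?R
  then obtain j where X: "X \<in> carrier_mat n n" and XAX: "X * A * X = X" and comm: "A * X = X * A"
    and j: "A ^\<^sub>m (j + 1) * X = A ^\<^sub>m j" by blast
  note sq = assoc_mult_mat[of _ n n _ n _ n] mult_carrier_mat[of _ n n _ n]
  define k where "k = mat_index A"
  obtain W where W: "W \<in> carrier_mat n n" and k: "A ^\<^sub>m k = A ^\<^sub>m (k + j) * W"
    using mat_index_pow_eq[OF A] unfolding k_def by blast
  note pow_comm = pow_mat_commute[OF A X comm]
  have "A ^\<^sub>m (k + 1) * X = X * (A * A ^\<^sub>m k)"
    using pow_comm[of "k + 1"] pow_mat_Suc_left[OF A, of k] by simp
  also have "\<dots> = X * (A * (A ^\<^sub>m j * A ^\<^sub>m k * W))"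
    using k pow_mat_add[OF A, of j k] by (simp add: add.commute)
  also have "\<dots> = X * A ^\<^sub>m (j + 1) * A ^\<^sub>m k * W"
    using pow_mat_Suc_left[OF A, of j] A X W by (simp add: sq)
  also have "\<dots> = A ^\<^sub>m j * A ^\<^sub>m k * W"
    using j pow_comm[of "j + 1"] by simp
  also have "\<dots> = A ^\<^sub>m k" using k pow_mat_add[OF A, of j k] by (simp add: add.commute)
  finally show "is_drazin_inverse A X"
    using A X XAX comm by (simp add: is_drazin_inverse_def k_def)
qed

text \<open>
For two Drazin inverses \<open>X\<close> and \<open>Y\<close>, the idempotent \<open>A X = X\<^sup>i A\<^sup>i\<close> is absorbed by \<open>A Y\<close> on the
right, and \<open>A Y = A\<^sup>i Y\<^sup>i\<close> is absorbed by \<open>A X\<close> on the left; so both equal \<open>A X A Y\<close>, and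
\<open>X = X A X = Y A Y = Y\<close>.
\<close>
lemma drazin_inverse_unique:
  assumes A: "A \<in> carrier_mat n n" and "is_drazin_inverse A X" "is_drazin_inverse A Y"
  shows "X = Y"
proof -
  note sq = assoc_mult_mat[of _ n n _ n _ n] mult_carrier_mat[of _ n n _ n]
  define k where "k = mat_index A"
  have X: "X \<in> carrier_mat n n" "X * A * X = X" "A * X = X * A" "A ^\<^sub>m (k + 1) * X = A ^\<^sub>m k"
    and Y: "Y \<in> carrier_mat n n" "Y * A * Y = Y" "A * Y = Y * A" "A ^\<^sub>m (k + 1) * Y = A ^\<^sub>m k"
    using assms by (auto simp: is_drazin_inverse_def k_def)
  have idem: "A * Z = A ^\<^sub>m i * Z ^\<^sub>m i" "A * Z = Z ^\<^sub>m i * A ^\<^sub>m i"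
    if "Z \<in> carrier_mat n n" "Z * A * Z = Z" "A * Z = Z * A" "i \<ge> 1" for Z i
    using that(4)
  proof (induction i rule: dec_induct)
    case base
    { case 1 show ?case using A that(1) by simp }
    { case 2 show ?case using A that(1,3) by simp }
  next
    case (step i)
        { case 1
      have "A ^\<^sub>m Suc i * Z ^\<^sub>m Suc i = A * (A ^\<^sub>m i * Z ^\<^sub>m i) * Z"
        using pow_mat_Suc_left[OF A, of i] A that(1) by (simp add: sq)
      also have "\<dots> = A * (A * Z) * Z" using step.IH(1) by simp
      also have "\<dots> = A * (Z * A * Z)" using A that(1,3) by (simp add: sq)
      finally show ?case using that(2) by simp }
    { case 2
      have "Z ^\<^sub>m Suc i * A ^\<^sub>m Suc i = Z * (Z ^\<^sub>m i * A ^\<^sub>m i) * A"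
        using pow_mat_Suc_left[OF that(1), of i] A that(1) by (simp add: sq)
      also have "\<dots> = Z * (A * Z) * A" using step.IH(2) by simp
      also have "\<dots> = Z * A * Z * A" using A that(1) by (simp add: sq)
      finally show ?case using that(2,3) by simp }
  qed
  have AX: "A * X = A * X * (A * Y)"
  proof -
    have "A ^\<^sub>m (k+1) = A * A ^\<^sub>m k" using pow_mat_Suc_left[OF A, of k] by simp
    also have "\<dots> = A * (A ^\<^sub>m (k + 1) * Y)" using Y(4) by simp
    also have "\<dots> = A ^\<^sub>m Suc (k + 1) * Y"
      unfolding pow_mat_Suc_left[OF A, of "k + 1"] using A Y(1) by (simp add: sq)
    also have "\<dots> = A ^\<^sub>m (k+1) * (A * Y)" using A Y(1) by (simp add: sq)
    finally have "X ^\<^sub>m (k+1) * A ^\<^sub>m (k+1) = X ^\<^sub>m (k+1) * (A ^\<^sub>m (k+1) * (A * Y))"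
      by simp
    also have "\<dots> = X ^\<^sub>m (k+1) * A ^\<^sub>m (k+1) * (A * Y)"
      by (rule assoc_mult_mat[symmetric, of _ n n _ n _ n]) (use A X(1) Y(1) in \<open>simp_all add: sq\<close>)
    finally have "X ^\<^sub>m (k+1) * A ^\<^sub>m (k+1) = X ^\<^sub>m (k+1) * A ^\<^sub>m (k+1) * (A * Y)" .
    then show ?thesis using idem(2)[OF X(1-3), of "k+1"] by simp
  qed
  have AY: "A * Y = A * X * (A * Y)"
  proof -
    note comm = pow_mat_commute[OF A X(1,3)]
    have "A ^\<^sub>m (k+1) = A * A ^\<^sub>m k" using pow_mat_Suc_left[OF A, of k] by simp
    also have "\<dots> = A * (X * A ^\<^sub>m (k + 1))" using X(4) comm[of "k+1"] by simp
    also have "\<dots> = A * X * A ^\<^sub>m (k+1)" using A X(1) by (simp add: sq)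
    finally have "A ^\<^sub>m (k+1) * Y ^\<^sub>m (k+1) = A * X * (A ^\<^sub>m (k+1) * Y ^\<^sub>m (k+1))"
      using A X(1) Y(1) assoc_mult_mat[of "A * X" n n "A ^\<^sub>m (k+1)" n "Y ^\<^sub>m (k+1)" n]
      by (simp del: pow_mat.simps)
    then show ?thesis using idem(1)[OF Y(1-3), of "k+1"] by simp
  qed
  have eq: "A * X = A * Y" using AX AY by simp
  have "X = X * (A * Y)" using X(1,2) A eq by (simp add: sq)
  also have "\<dots> = (A * Y) * Y" using X(3) eq A Y(1) X(1) by (metis sq)
  also have "\<dots> = Y" using Y A by simp
  finally show ?thesis .
qed

text \<open>
If \<open>A\<^sup>j = A\<^sup>2\<^sup>j\<^sup>+\<^sup>1 V = W A\<^sup>2\<^sup>j\<^sup>+\<^sup>1\<close>, then \<open>A\<^sup>j V = W A\<^sup>2\<^sup>j\<^sup>+\<^sup>1 V = W A\<^sup>j\<close> is the Drazin inverse.  The first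
equation holds for \<open>j\<close> above the index of \<open>A\<close>, the second, by transposition, for \<open>j\<close> above the
index of the transpose.
\<close>
lemma ex_drazin_inverse:
  assumes A: "A \<in> carrier_mat n n"
  shows "\<exists>X. is_drazin_inverse A X"
proof -
  note sq = assoc_mult_mat[of _ n n _ n _ n] mult_carrier_mat[of _ n n _ n]
  define j where "j = max (mat_index A) (mat_index (transpose_mat A))"
  obtain V where V: "V \<in> carrier_mat n n" and AV: "A ^\<^sub>m j = A ^\<^sub>m (j + (j + 1)) * V"
    using mat_index_pow_eq_ge[OF A, of j "j + 1"] by (auto simp: j_def)
  have "transpose_mat A \<in> carrier_mat n n" using A by simp
  then obtain W' where W': "W' \<in> carrier_mat n n"
    "transpose_mat A ^\<^sub>m j = transpose_mat A ^\<^sub>m (j + (j + 1)) * W'"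
    using mat_index_pow_eq_ge[of "transpose_mat A" n j "j + 1"] by (auto simp: j_def)
  define W where "W = transpose_mat W'"
  have W: "W \<in> carrier_mat n n" using W'(1) by (simp add: W_def)
  have "A ^\<^sub>m j = transpose_mat (transpose_mat (A ^\<^sub>m j))" by simp
  also have "\<dots> = transpose_mat (transpose_mat (A ^\<^sub>m (j + (j + 1))) * W')"
    using W'(2) transpose_pow_mat[OF A] by (simp del: pow_mat.simps)
  also have "\<dots> = W * A ^\<^sub>m (j + (j + 1))"
    using transpose_mult[of "transpose_mat (A ^\<^sub>m (j + (j + 1)))" n n W' n]
      pow_carrier_mat[OF A, of "j + (j + 1)"] W'(1)
    by (simp add: W_def del: pow_mat.simps)
  finally have WA: "A ^\<^sub>m j = W * A ^\<^sub>m (j + (j + 1))" .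
  define X where "X = A ^\<^sub>m j * V"
  have X: "X \<in> carrier_mat n n" using A V by (simp add: X_def sq)
  have X': "X = W * A ^\<^sub>m j"
  proof -
    have "X = W * (A ^\<^sub>m (j + (j + 1)) * V)" unfolding X_def by (subst WA) (use A V W in \<open>simp add: sq\<close>)
    then show ?thesis using AV by simp
  qed
  have "A * X = A * A ^\<^sub>m j * V" using A V by (simp add: X_def sq)
  also have "A * A ^\<^sub>m j = A ^\<^sub>m j * A" using pow_mat_Suc_left[OF A, of j] by simp
  also have "\<dots> = W * A ^\<^sub>m (j + (j + 1)) * A" by (simp only: WA[symmetric])
  also have "\<dots> = W * (A * A ^\<^sub>m (j + (j + 1)))"
    using pow_mat_Suc_left[OF A, of "j + (j + 1)"] A W by (simp add: sq)
  also have "\<dots> * V = W * A * (A ^\<^sub>m (j + (j + 1)) * V)" using A V W by (simp add: sq del: pow_mat.simps)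
  also have "\<dots> = W * A * A ^\<^sub>m j" by (simp only: AV[symmetric])
  also have "\<dots> = W * (A * A ^\<^sub>m j)" using A W by (simp add: sq)
  also have "\<dots> = X * A" using pow_mat_Suc_left[OF A, of j] A W by (simp add: X' sq)
  finally have comm: "A * X = X * A" .
  have "X * A * X = W * (A ^\<^sub>m j * A * A ^\<^sub>m j) * V"
    using A V W by (subst X', simp add: X_def sq)
  also have "A ^\<^sub>m j * A * A ^\<^sub>m j = A ^\<^sub>m (j + (j + 1))"
    using pow_mat_add[OF A, of "j + 1" j] by (simp add: ac_simps)
  also have "W * \<dots> * V = X" using WA X_def by simp
  finally have XAX: "X * A * X = X" .
  have "A ^\<^sub>m (j + 1) * X = A ^\<^sub>m (j + 1) * A ^\<^sub>m j * V" using A V by (simp add: X_def sq)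
  also have "\<dots> = A ^\<^sub>m j" using pow_mat_add[OF A, of "j + 1" j] AV by (simp add: ac_simps)
  finally show ?thesis using X XAX comm unfolding is_drazin_inverse_iff[OF A] by blast
qed

lemma drazin_inverse_is_drazin:
  assumes "A \<in> carrier_mat n n"
  shows "is_drazin_inverse A (drazin_inverse A)"
  unfolding drazin_inverse_def
  using ex_drazin_inverse[OF assms] drazin_inverse_unique[OF assms] by (blast intro: theI)

lemma drazin_inverse_eqI:
  assumes A: "A \<in> carrier_mat n n" and "X \<in> carrier_mat n n" "X * A * X = X" "A * X = X * A"
    "A ^\<^sub>m (j + 1) * X = A ^\<^sub>m j"
  shows "drazin_inverse A = X"
  using drazin_inverse_unique[OF A drazin_inverse_is_drazin[OF A]] is_drazin_inverse_iff[OF A] assms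
  by blast

lemma drazin_inverse_carrier [simp]:
  assumes "A \<in> carrier_mat n n"
  shows "drazin_inverse A \<in> carrier_mat n n"
  using drazin_inverse_is_drazin[OF assms] assms by (simp add: is_drazin_inverse_def)

text \<open>
Read from left to right, these equations move \<open>A\<close> in front of \<open>D\<close> and cancel one \<open>A\<close> against one
of two adjacent \<open>D\<close>, in right-associated products.
\<close>
lemma drazin_inverse_rewrites:
  assumes A: "A \<in> carrier_mat n n"
  defines "D \<equiv> drazin_inverse A"
  shows "D * A = A * D" "A * (D * D) = D"
    and "Z \<in> carrier_mat n m \<Longrightarrow> D * (A * Z) = A * (D * Z)"
    and "Z \<in> carrier_mat n m \<Longrightarrow> A * (D * (D * Z)) = D * Z"
proof -
  have D: "D \<in> carrier_mat n n" "D * A * D = D" "A * D = D * A"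
    using drazin_inverse_is_drazin[OF A] A by (auto simp: is_drazin_inverse_def D_def)
  show 1: "D * A = A * D" using D by simp
  show 2: "A * (D * D) = D" using D A assoc_mult_mat by metis
  show "D * (A * Z) = A * (D * Z)" if Z: "Z \<in> carrier_mat n m"
    using 1 assoc_mult_mat[OF D(1) A Z] assoc_mult_mat[OF A D(1) Z] by simp
  show "A * (D * (D * Z)) = D * Z" if Z: "Z \<in> carrier_mat n m"
    using mult_mat_extend[OF 2 A _ Z] assoc_mult_mat[OF D(1) D(1) Z] D(1) by simp
qed

lemma pow_mult_drazin_inverse:
  assumes A: "A \<in> carrier_mat n n" and "mat_index A \<le> j"
  shows "A ^\<^sub>m (j + 1) * drazin_inverse A = A ^\<^sub>m j"
proof -
  note sq = assoc_mult_mat[of _ n n _ n _ n] mult_carrier_mat[of _ n n _ n]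
  obtain i where j: "j = i + mat_index A" using assms(2) by (metis le_add_diff_inverse2)
  have "A ^\<^sub>m (j + 1) * drazin_inverse A = A ^\<^sub>m i * (A ^\<^sub>m (mat_index A + 1) * drazin_inverse A)"
    using pow_mat_add[OF A, of i "mat_index A"] A by (simp add: j sq)
  also have "\<dots> = A ^\<^sub>m j"
    using drazin_inverse_is_drazin[OF A] pow_mat_add[OF A, of i "mat_index A"]
    by (simp add: is_drazin_inverse_def j)
  finally show ?thesis .
qed

lemma drazin_inverse_pow_mult_pow:
  assumes A: "A \<in> carrier_mat n n"
  shows "drazin_inverse A ^\<^sub>m (m + 1) * A ^\<^sub>m m = drazin_inverse A"
proof (induction m)
  case (Suc m)
  note sq = assoc_mult_mat[of _ n n _ n _ n] mult_carrier_mat[of _ n n _ n]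
  define D where "D = drazin_inverse A"
  have D: "D \<in> carrier_mat n n" using A by (simp add: D_def)
  have "D ^\<^sub>m (Suc m + 1) * A ^\<^sub>m Suc m = D * (D ^\<^sub>m (m + 1) * A ^\<^sub>m m) * A"
    using pow_mat_Suc_left[OF D, of "m + 1"] A D by (simp add: sq)
  also have "\<dots> = D * D * A" using Suc by (simp add: D_def)
  also have "\<dots> = D" using drazin_inverse_rewrites[OF A, folded D_def] A D by (simp add: sq)
  finally show ?case by (simp add: D_def)
qed (use right_mult_one_mat[OF drazin_inverse_carrier[OF assms]] assms in simp)

text \<open>
The double Drazin inverse is the core part of \<open>A\<close>.  Core part and Drazin inverse are inverse to
each other on the same range, hence the third Drazin inverse is the first.
\<close>
lemma drazin_inverse_drazin_inverse:
  assumes A: "A \<in> carrier_mat n n"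
  shows "drazin_inverse (drazin_inverse A) = A * A * drazin_inverse A"
proof -
  note sq = assoc_mult_mat[of _ n n _ n _ n] mult_carrier_mat[of _ n n _ n]
  note rw = drazin_inverse_rewrites[OF A]
  show ?thesis
    by (rule drazin_inverse_eqI[of _ n _ 1])
      (use A in \<open>simp_all add: sq rw rw(3,4)[of _ n]\<close>)
qed

lemma drazin_inverse_thrice:
  assumes A: "A \<in> carrier_mat n n"
  shows "drazin_inverse (drazin_inverse (drazin_inverse A)) = drazin_inverse A"
proof -
  note sq = assoc_mult_mat[of _ n n _ n _ n] mult_carrier_mat[of _ n n _ n]
  note rw = drazin_inverse_rewrites[OF A]
  show ?thesis
    unfolding drazin_inverse_drazin_inverse[OF A]
    by (rule drazin_inverse_eqI[of _ n _ 1])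
      (use A in \<open>simp_all add: sq rw rw(3,4)[of _ n]\<close>)
qed

text \<open>
Cline's formula.  With \<open>T = H F\<close> one has \<open>(F H)\<^sup>i\<^sup>+\<^sup>1 = F T\<^sup>i H\<close>, which reduces the equations for
the right-hand side to those of the Drazin inverse of \<open>T\<close>.
\<close>
lemma drazin_inverse_mult_swap:
  assumes F: "F \<in> carrier_mat n r" and H: "H \<in> carrier_mat r n"
  shows "drazin_inverse (F * H) = F * drazin_inverse (H * F) * drazin_inverse (H * F) * H"
proof -
  define T where "T = H * F"
  define E where "E = drazin_inverse T"
  have T: "T \<in> carrier_mat r r" using F H by (simp add: T_def)
  have E: "E \<in> carrier_mat r r" using T by (simp add: E_def)
  note c = F H T E
  note as = assoc_mult_mat[of _ n r _ r _ n] assoc_mult_mat[of _ n r _ n _ r] assoc_mult_mat[of _ n r _ r _ r]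
    assoc_mult_mat[of _ r n _ r _ n] assoc_mult_mat[of _ r n _ r _ r] assoc_mult_mat[of _ r r _ r _ n]
    assoc_mult_mat[of _ r r _ r _ r] assoc_mult_mat[of _ n r _ n _ n] assoc_mult_mat[of _ r r _ n _ n] assoc_mult_mat[of _ r n _ n _ n]
    mult_carrier_mat[of _ n r _ r] mult_carrier_mat[of _ r r _ r] mult_carrier_mat[of _ r r _ n]
    mult_carrier_mat[of _ n r _ n] mult_carrier_mat[of _ r n _ r]
  have HF: "H * F = T" by (simp add: T_def)
  have HFZ: "H * (F * Z) = T * Z" if "Z \<in> carrier_mat r m" for Z m
    using mult_mat_extend[OF HF H F that] .
  note rw = drazin_inverse_rewrites[OF T, folded E_def]
  have pow: "(F * H) ^\<^sub>m (i + 1) = F * T ^\<^sub>m i * H" for i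
  proof (induction i)
    case (Suc i)
    have "(F * H) ^\<^sub>m (Suc i + 1) = (F * T ^\<^sub>m i * H) * (F * H)" using Suc by simp
    also have "\<dots> = F * T ^\<^sub>m Suc i * H"
      using c HFZ[of H n] by (simp add: as)
    finally show ?case .
  qed (use F H T in simp)
  have "drazin_inverse (F * H) = F * (E * (E * H))"
  proof (rule drazin_inverse_eqI[of _ n _ "mat_index T + 1"])
    show "F * (E * (E * H)) * (F * H) * (F * (E * (E * H))) = F * (E * (E * H))"
      using c by (simp add: as HFZ[of _ n] rw(1,2) rw(3,4)[of _ n])
    show "F * H * (F * (E * (E * H))) = F * (E * (E * H)) * (F * H)"
      using c by (simp add: as HFZ[of _ n] rw(1,2) rw(3,4)[of _ n])
    have "(F * H) ^\<^sub>m (mat_index T + 1 + 1) * (F * (E * (E * H)))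
        = F * (T ^\<^sub>m (mat_index T + 1) * (T * (E * (E * H))))"
      using c pow[of "mat_index T + 1"] by (simp add: as HFZ[of _ n])
    also have "T * (E * (E * H)) = E * H" using rw(4)[OF H] .
    also have "T ^\<^sub>m (mat_index T + 1) * (E * H) = T ^\<^sub>m mat_index T * H"
      by (rule mult_mat_extend[OF pow_mult_drazin_inverse[OF T order_refl, folded E_def] _ E H])
        (rule pow_carrier_mat[OF T])
    finally show "(F * H) ^\<^sub>m (mat_index T + 1 + 1) * (F * (E * (E * H))) = (F * H) ^\<^sub>m (mat_index T + 1)"
      using pow[of "mat_index T"] c by (simp add: as)
  qed (use c in \<open>simp_all add: as\<close>)
  then show ?thesis using c by (simp add: E_def[symmetric] T_def[symmetric] as)
qed

section \<open>Conjugate transposes and the Minkowski metric\<close>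

lemma mat_adjoint_index:
  fixes A :: "complex mat"
  shows "mat_adjoint A = mat (dim_col A) (dim_row A) (\<lambda>(i, j). cnj (A $$ (j, i)))"
  unfolding mat_adjoint_def by (rule eq_matI) (auto simp: mat_of_rows_index)

lemma mat_adjoint_carrier [simp]:
  fixes A :: "complex mat"
  assumes "A \<in> carrier_mat m p"
  shows "mat_adjoint A \<in> carrier_mat p m"
  using assms by (auto simp: mat_adjoint_index)

lemma mat_adjoint_mult:
  fixes A B :: "complex mat"
  assumes "A \<in> carrier_mat m p" "B \<in> carrier_mat p q"
  shows "mat_adjoint (A * B) = mat_adjoint B * mat_adjoint A"
  by (rule eq_matI) (use assms in \<open>auto simp: mat_adjoint_index scalar_prod_def mult.commute\<close>)

lemma mat_adjoint_adjoint [simp]: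
  fixes A :: "complex mat"
  shows "mat_adjoint (mat_adjoint A) = A"
  by (rule eq_matI) (auto simp: mat_adjoint_index)

lemma mat_adjoint_one [simp]: "mat_adjoint (1\<^sub>m m :: complex mat) = 1\<^sub>m m"
  by (rule eq_matI) (auto simp: mat_adjoint_index)

lemma mat_adjoint_four_block:
  fixes A :: "complex mat"
  assumes "A \<in> carrier_mat nr1 nc1" "B \<in> carrier_mat nr1 nc2" "C \<in> carrier_mat nr2 nc1"
    "D \<in> carrier_mat nr2 nc2"
  shows "mat_adjoint (four_block_mat A B C D)
    = four_block_mat (mat_adjoint A) (mat_adjoint C) (mat_adjoint B) (mat_adjoint D)"
  by (rule eq_matI) (use assms in \<open>auto simp: mat_adjoint_index\<close>)

lemma minkowski_metric_carrier [simp]: "minkowski_metric n \<in> carrier_mat n n"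
  by (simp add: minkowski_metric_def)

lemma minkowski_metric_square: "minkowski_metric n * minkowski_metric n = 1\<^sub>m n"
  unfolding minkowski_metric_def mat_diag_diag by (rule eq_matI) (auto simp: mat_diag_def)

lemma mat_adjoint_minkowski_metric [simp]:
  "mat_adjoint (minkowski_metric n) = minkowski_metric n"
  by (rule eq_matI) (auto simp: mat_adjoint_index minkowski_metric_def mat_diag_def)

lemma minkowski_metric_rewrites:
  assumes "Z \<in> carrier_mat n m"
  shows "minkowski_metric n * (minkowski_metric n * Z) = Z"
  using mult_mat_extend[OF minkowski_metric_square[of n] minkowski_metric_carrier minkowski_metric_carrier assms] assms
  by simp

lemma minkowski_adjoint_eq:
  assumes "A \<in> carrier_mat n n"
  shows "minkowski_adjoint A = minkowski_metric n * mat_adjoint A * minkowski_metric n"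
  using assms by (simp add: minkowski_adjoint_def)

lemma minkowski_adjoint_carrier [simp]:
  assumes "A \<in> carrier_mat n n"
  shows "minkowski_adjoint A \<in> carrier_mat n n"
  unfolding minkowski_adjoint_eq[OF assms]
  by (rule mult_carrier_mat[OF mult_carrier_mat[OF minkowski_metric_carrier mat_adjoint_carrier[OF assms]]
        minkowski_metric_carrier])

lemma minkowski_adjoint_mult:
  assumes "A \<in> carrier_mat n n" "B \<in> carrier_mat n n"
  shows "minkowski_adjoint (A * B) = minkowski_adjoint B * minkowski_adjoint A"
proof -
  note sq = assoc_mult_mat[of _ n n _ n _ n] mult_carrier_mat[of _ n n _ n]
  show ?thesis
    using assms minkowski_adjoint_eq[of "A * B" n]
    by (simp add: minkowski_adjoint_eq[of _ n] mat_adjoint_mult[of _ n n _ n] sq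
        minkowski_metric_rewrites[of _ n n])
qed

section \<open>The Minkowski inverse\<close>

text \<open>
Penrose's argument: \<open>A X = (A Y)(A X)\<close>, and taking adjoints reverses the two symmetric factors,
so \<open>A X = (A X)(A Y) = A Y\<close>; in the same way \<open>X A = Y A\<close>.
\<close>
lemma is_minkowski_inverse_unique:
  assumes A: "A \<in> carrier_mat n n" and "is_minkowski_inverse A X" "is_minkowski_inverse A Y"
  shows "X = Y"
proof -
  note sq = assoc_mult_mat[of _ n n _ n _ n] mult_carrier_mat[of _ n n _ n]
  have X: "X \<in> carrier_mat n n" "A * X * A = A" "X * A * X = X"
      "minkowski_adjoint (A * X) = A * X" "minkowski_adjoint (X * A) = X * A"
    and Y: "Y \<in> carrier_mat n n" "A * Y * A = A" "Y * A * Y = Y"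
      "minkowski_adjoint (A * Y) = A * Y" "minkowski_adjoint (Y * A) = Y * A"
    using assms unfolding is_minkowski_inverse_def by auto
  have AYAZ: "A * (Y * (A * Z)) = A * Z" and AXAZ: "A * (X * (A * Z)) = A * Z"
    if "Z \<in> carrier_mat n n" for Z
    using mult_mat_extend[OF Y(2) _ A that, of n] mult_mat_extend[OF X(2) _ A that, of n] A X(1) Y(1) that
    by (simp_all add: sq)
  have "A * X = A * Y * (A * X)" using A X(1) Y(1) by (simp add: sq AYAZ)
  then have "minkowski_adjoint (A * X) = A * X * (A * Y)"
    using minkowski_adjoint_mult[of "A * Y" n "A * X"] A X Y by simp
  also have "\<dots> = A * Y" using A X(1) Y(1) by (simp add: sq AXAZ)
  finally have AX: "A * X = A * Y" using X(4) by simp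
  have AYA: "A * (Y * A) = A" and AXA: "A * (X * A) = A" using A X(1,2) Y(1,2) by (simp_all add: sq)
  have "X * A = X * A * (Y * A)" using A X(1) Y(1) by (simp add: sq AYA)
  then have "minkowski_adjoint (X * A) = Y * A * (X * A)"
    using minkowski_adjoint_mult[of "X * A" n "Y * A"] A X Y by simp
  also have "\<dots> = Y * A" using A X(1) Y(1) by (simp add: sq AXA)
  finally have XA: "X * A = Y * A" using X(5) by simp
  have "X = Y * A * X" using X(3) XA by simp
  also have "\<dots> = Y * A * Y" using A X(1) Y(1) AX by (simp add: sq)
  finally show ?thesis using Y(3) by simp
qed

lemma minkowski_inverse_eqI:
  assumes "A \<in> carrier_mat n n" "is_minkowski_inverse A X"
  shows "minkowski_inverse A = X"
  unfolding minkowski_inverse_def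
  using is_minkowski_inverse_unique[OF assms(1)] assms(2) by blast

lemma mat_adjoint_dim [simp]:
  fixes A :: "complex mat"
  shows "dim_row (mat_adjoint A) = dim_col A" "dim_col (mat_adjoint A) = dim_row A"
  by (simp_all add: mat_adjoint_index)

lemma minkowski_metric_dim [simp]:
  "dim_row (minkowski_metric n) = n" "dim_col (minkowski_metric n) = n"
  by (simp_all add: minkowski_metric_def mat_diag_def)

text \<open>
For products of rectangular matrices, conditions on dimensions are better rewrite rules than
membership in carriers: the simplifier computes dimensions, but would have to guess the inner
dimensions of a carrier condition.
\<close>
lemma mult_mat_assoc:
  fixes A B C :: "'a :: semiring_0 mat"
  assumes "dim_col A = dim_row B" "dim_col B = dim_row C"
  shows "A * B * C = A * (B * C)"
  using assms by (intro assoc_mult_mat) auto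

lemma mult_mat_rewrite:
  fixes A B C Z :: "'a :: semiring_0 mat"
  assumes "A * B = C" "dim_col A = dim_row B" "dim_col B = dim_row Z"
  shows "A * (B * Z) = C * Z"
  using assms mult_mat_assoc by metis

lemma mat_adjoint_mult_dim:
  fixes A B :: "complex mat"
  assumes "dim_col A = dim_row B"
  shows "mat_adjoint (A * B) = mat_adjoint B * mat_adjoint A"
  using assms by (intro mat_adjoint_mult) auto

lemma hermitian_inverse_hermitian:
  assumes X: "X \<in> carrier_mat m m" and Y: "Y \<in> carrier_mat m m"
    and herm: "mat_adjoint X = X" and XY: "X * Y = 1\<^sub>m m" and YX: "Y * X = 1\<^sub>m m"
  shows "mat_adjoint Y = (Y :: complex mat)"
proof -
  have "mat_adjoint Y * X = 1\<^sub>m m" using mat_adjoint_mult[OF X Y] herm XY by simp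
  then have "mat_adjoint Y * X * Y = Y" using Y by simp
  moreover have "mat_adjoint Y * X * Y = mat_adjoint Y"
    using assoc_mult_mat[OF mat_adjoint_carrier[OF Y] X Y] XY Y by simp
  ultimately show ?thesis by simp
qed

text \<open>
Put \<open>P = G H\<^sup>*\<close>, \<open>G\<^sub>1 = F\<^sup>* G F\<close> and \<open>N = H G H\<^sup>*\<close>.  The product in the rank hypothesis is
\<open>P R\<close> with \<open>R = G\<^sub>1 N F\<^sup>* G\<close>.  Since \<open>P\<close> has only \<open>r\<close> columns, \<open>P R\<close> and \<open>P\<close> have the same
rank, so \<open>P = P R W\<close> for some \<open>W\<close>.  The matrix \<open>C\<close>, an inverse of \<open>H H\<^sup>*\<close>, allows to cancel
\<open>P\<close> on the left.  The result \<open>G\<^sub>1 N F\<^sup>* G W = 1\<close> makes the square matrices \<open>G\<^sub>1\<close> and \<open>N\<close> invertible,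
and \<open>P N\<^sup>-\<^sup>1 G\<^sub>1\<^sup>-\<^sup>1 F\<^sup>* G\<close> is the Minkowski inverse.
\<close>
lemma minkowski_inverse_of_full_rank_factorization:
  fixes n r :: nat and F H C A :: "complex mat"
  defines "G \<equiv> minkowski_metric n"
  assumes F: "F \<in> carrier_mat n r" and H: "H \<in> carrier_mat r n" and A: "A = F * H"
    and C: "C \<in> carrier_mat r r" "C * (H * mat_adjoint H) = 1\<^sub>m r"
    and rank_A: "mat_rank A = r"
    and rank: "mat_rank (minkowski_adjoint A * A * minkowski_adjoint A) = mat_rank A"
  shows "\<exists>B \<in> carrier_mat r r. mat_adjoint F * G * F * B = 1\<^sub>m r \<and> B * (mat_adjoint F * G * F) = 1\<^sub>m r \<and>
    (\<exists>M. is_minkowski_inverse A M \<and> A * M = F * B * mat_adjoint F * G)"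
proof -
  define F' where "F' = mat_adjoint F"
  define H' where "H' = mat_adjoint H"
  define P where "P = G * H'"
  define G1 where "G1 = F' * G * F"
  define N where "N = H * G * H'"
  have G: "G \<in> carrier_mat n n" by (simp add: G_def)
  have c: "F' \<in> carrier_mat r n" "H' \<in> carrier_mat n r" using F H by (simp_all add: F'_def H'_def)
  have P: "P \<in> carrier_mat n r" and G1: "G1 \<in> carrier_mat r r" and N: "N \<in> carrier_mat r r"
    using F H G c by (auto simp: P_def G1_def N_def)
  have A_carrier: "A \<in> carrier_mat n n" using A F H by simp
  note dims = carrier_matD[OF F] carrier_matD[OF H] carrier_matD[OF G] carrier_matD[OF c(1)]
    carrier_matD[OF c(2)] carrier_matD[OF P] carrier_matD[OF G1] carrier_matD[OF N] carrier_matD[OF C(1)]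
  have GG: "G * G = 1\<^sub>m n" by (simp add: G_def minkowski_metric_square)
  have GGZ: "G * (G * Z) = Z" if "dim_row Z = n" for Z
    using mult_mat_rewrite[OF GG, of Z] that G by simp
  have G1_eq: "F' * (G * F) = G1" and N_eq: "H * P = N" by (simp_all add: G1_def N_def P_def mult_mat_assoc dims)
  have adj: "minkowski_adjoint A = P * (F' * G)"
    using minkowski_adjoint_eq[OF A_carrier]
    by (simp add: A mat_adjoint_mult_dim mult_mat_assoc dims P_def F'_def H'_def flip: G_def)
  define R where "R = G1 * (N * (F' * G))"
  have R: "R \<in> carrier_mat r n" using G1 N G c by (auto simp: R_def)
  have PR: "minkowski_adjoint A * A * minkowski_adjoint A = P * R"
    unfolding adj unfolding R_def A
    by (simp add: mult_mat_assoc dims mult_mat_rewrite[OF N_eq] flip: G1_eq)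
  have "mat_rank P \<le> r" using vec_space.rank_le_nc[OF P] P by simp
  moreover have "mat_rank (P * R) \<le> mat_rank P" by (rule mat_rank_mult_le(1)[OF P R])
  ultimately have "mat_rank (P * R) = mat_rank P" using rank rank_A PR by simp
  then obtain W where W: "W \<in> carrier_mat n r" and PRW: "P * R * W = P"
    using mat_rank_mult_le(2)[OF P R] by blast
  note dims = dims carrier_matD[OF R] carrier_matD[OF W]
  have CP: "C * H * G * P = 1\<^sub>m r"
    using C(2) by (simp add: P_def mult_mat_assoc dims GGZ H'_def)
  have "C * H * G * (P * R * W) = R * W"
  proof -
    have "C * H * G * (P * R * W) = (C * H * G * P) * (R * W)"
      by (simp add: mult_mat_assoc dims)
    then show ?thesis unfolding CP using R W by simp
  qed
  then have RW: "R * W = 1\<^sub>m r" unfolding PRW CP by simp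
  \<comment> \<open>A one-sided inverse of a square matrix is two-sided; this gives the inverses of both factors.\<close>
  define B where "B = N * (F' * (G * W))"
  have B: "B \<in> carrier_mat r r" using N c G W by (auto simp: B_def)
  have G1B: "G1 * B = 1\<^sub>m r" using RW by (simp add: R_def B_def mult_mat_assoc dims)
  have BG1: "B * G1 = 1\<^sub>m r" by (rule mat_mult_left_right_inverse[OF G1 B G1B])
  define N' where "N' = F' * (G * (W * G1))"
  have N': "N' \<in> carrier_mat r r" using c G W G1 by (auto simp: N'_def)
  have NN': "N * N' = 1\<^sub>m r" using BG1 by (simp add: N'_def B_def mult_mat_assoc dims)
  have N'N: "N' * N = 1\<^sub>m r" by (rule mat_mult_left_right_inverse[OF N N' NN'])
  note dims = dims carrier_matD[OF B] carrier_matD[OF N']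
  have G': "mat_adjoint G = G" by (simp add: G_def)
  have "mat_adjoint G1 = G1"
    by (simp add: G1_def F'_def mat_adjoint_mult_dim dims mult_mat_assoc G')
  then have B': "mat_adjoint B = B" using hermitian_inverse_hermitian[OF G1 B _ G1B BG1] by simp
  have "mat_adjoint N = N"
    by (simp add: N_def H'_def mat_adjoint_mult_dim dims mult_mat_assoc G')
  then have N'': "mat_adjoint N' = N'" using hermitian_inverse_hermitian[OF N N' _ NN' N'N] by simp
  define M where "M = P * (N' * (B * (F' * G)))"
  have M: "M \<in> carrier_mat n n" using P N' B c G by (auto simp: M_def)
  note rw = mult_mat_assoc dims N_eq mult_mat_rewrite[OF N_eq] NN' mult_mat_rewrite[OF NN']
    G1_eq mult_mat_rewrite[OF BG1] BG1
  have G1Z: "F' * (G * (F * Z)) = G1 * Z" if "dim_row Z = r" for Z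
    unfolding G1_eq[symmetric] by (simp add: mult_mat_assoc dims that)
  have one: "1\<^sub>m r * Z = Z" if "dim_row Z = r" for Z :: "complex mat"
    using left_mult_one_mat'[of Z r] that by auto
  have AM: "A * M = F * (B * (F' * G))" by (simp add: A M_def rw one)
  have MA: "M * A = P * (N' * H)" by (simp add: A M_def rw G1Z one)
  have "is_minkowski_inverse A M"
    unfolding is_minkowski_inverse_def
  proof (intro conjI)
    show "M \<in> carrier_mat (dim_row A) (dim_row A)" using M A_carrier by simp
    show "A * M * A = A" unfolding AM unfolding A by (simp add: rw G1Z one)
    show "M * A * M = M" unfolding MA unfolding M_def by (simp add: rw one)
    have "minkowski_adjoint (A * M) = G * mat_adjoint (F * (B * (F' * G))) * G"
      using minkowski_adjoint_eq[OF mult_carrier_mat[OF A_carrier M]] unfolding AM G_def[symmetric] .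
    also have "mat_adjoint (F * (B * (F' * G))) = G * (F * (B * F'))"
      by (simp add: mat_adjoint_mult_dim dims mult_mat_assoc G' B' F'_def)
    also have "G * \<dots> * G = F * (B * (F' * G))" by (simp add: mult_mat_assoc dims GGZ)
    finally show "minkowski_adjoint (A * M) = A * M" unfolding AM .
    have "minkowski_adjoint (M * A) = G * mat_adjoint (P * (N' * H)) * G"
      using minkowski_adjoint_eq[OF mult_carrier_mat[OF M A_carrier]] unfolding MA G_def[symmetric] .
    also have "mat_adjoint (P * (N' * H)) = H' * (N' * (H * G))"
      by (simp add: mat_adjoint_mult_dim dims mult_mat_assoc G' N'' H'_def P_def)
    also have "G * \<dots> * G = P * (N' * H)" using right_mult_one_mat[OF H]
      by (simp add: mult_mat_assoc dims GG P_def)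
    finally show "minkowski_adjoint (M * A) = M * A" unfolding MA .
  qed
  moreover have "A * M = F * B * F' * G" unfolding AM by (simp add: mult_mat_assoc dims)
  ultimately show ?thesis
    using B G1B BG1 unfolding F'_def G1_def by blast
qed

section \<open>The m-DMP inverse\<close>

text \<open>
In this context every property of the m-DMP inverse is a consequence of the defining equations of the
Drazin inverse of \<open>A\<close> and of a Minkowski inverse \<open>M\<close>.
\<close>
locale minkowski_invertible =
  fixes n :: nat and A M :: "complex mat"
  assumes A [simp]: "A \<in> carrier_mat n n"
    and M_inv: "is_minkowski_inverse A M"
begin

abbreviation "D \<equiv> drazin_inverse A"

lemma M [simp]: "M \<in> carrier_mat n n"
  using M_inv A by (simp add: is_minkowski_inverse_def)

lemma minkowski_inverse_eq: "minkowski_inverse A = M"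
  using minkowski_inverse_eqI[OF A M_inv] .

lemma m_dmp_inverse_eq: "m_dmp_inverse A = D * A * M"
  by (simp add: m_dmp_inverse_def minkowski_inverse_eq)

lemmas sq = assoc_mult_mat[of _ n n _ n _ n] mult_carrier_mat[of _ n n _ n]

lemma AMA: "A * M * A = A" and MAM: "M * A * M = M" and AM_sym: "minkowski_adjoint (A * M) = A * M"
  using M_inv by (simp_all add: is_minkowski_inverse_def)

lemmas drazin_rw = drazin_inverse_rewrites[OF A] drazin_inverse_rewrites(3,4)[OF A, of _ n]

text \<open>
Absorption, as \<open>D\<close> has its range inside that of \<open>A\<close>; the dual law below uses \<open>D = D\<^sup>2 A\<close>.
\<close>
lemma AMD: "A * (M * D) = D"
proof -
  have "A * (M * D) = A * (M * (A * (D * D)))" using drazin_rw(2) by simp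
  also have "\<dots> = A * M * A * (D * D)" by (simp add: sq)
  also have "\<dots> = D" using AMA drazin_rw(2) by simp
  finally show ?thesis .
qed

lemma DMA: "D * (M * A) = D"
proof -
  have D: "D = D * (D * A)" by (simp add: drazin_rw sq)
  have "D * (M * A) = D * (D * (A * (M * A)))" by (subst D) (simp add: sq)
  also have "A * (M * A) = A" using AMA by (simp add: sq)
  finally show ?thesis using D by simp
qed

lemma extended_rw:
  assumes Z: "Z \<in> carrier_mat n n"
  shows "A * (M * (A * Z)) = A * Z" "A * (M * (D * Z)) = D * Z" "M * (A * (M * Z)) = M * Z"
    "D * (M * (A * Z)) = D * Z"
  using mult_mat_extend[OF AMA _ _ Z, of n n] mult_mat_extend[OF MAM _ _ Z, of n n]
    mult_mat_extend[OF AMD _ _ Z, of n n]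
    mult_mat_extend[OF DMA _ _ Z, of n n] Z by (simp_all add: sq)

text \<open>
\<open>A\<close> and \<open>D\<close> commute, so an \<open>A\<close> that is needed for an absorption may have been moved away from \<open>M\<close>;
the rules with \<open>D\<close> in place of \<open>A\<close> make the rewrite system confluent enough to decide the
identities between words in \<open>A, D, M\<close> below.
\<close>
lemmas rw = drazin_rw AMA[unfolded sq(1)[OF A M A]] MAM[unfolded sq(1)[OF M A M]] AMD DMA extended_rw

text \<open>
Taking adjoints of \<open>A = (A M) A\<close> shows that the adjoint of \<open>A\<close> is a left multiple of \<open>A M\<close>; taking
adjoints of \<open>A M\<close> itself shows the converse.
\<close>
lemma kernel_minkowski_adjoint: "mat_kernel (minkowski_adjoint A) = mat_kernel (A * M)"
proof -
  have AM: "A * M \<in> carrier_mat n n" by (simp add: sq)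
  have 1: "minkowski_adjoint A = minkowski_adjoint A * (A * M)"
    using minkowski_adjoint_mult[OF AM A] AMA AM_sym by simp
  have 2: "A * M = minkowski_adjoint M * minkowski_adjoint A"
    using minkowski_adjoint_mult[OF A M] AM_sym by simp
  show ?thesis
    using mat_kernel_mult_subset[OF AM minkowski_adjoint_carrier[OF A], folded 1]
      mat_kernel_mult_subset[OF minkowski_adjoint_carrier[OF A] minkowski_adjoint_carrier[OF M], folded 2]
    by blast
qed

lemma direct_sum_range_kernel: "direct_sum_vec n (mat_range A) (mat_kernel (minkowski_adjoint A))"
  unfolding direct_sum_vec_def
proof (intro conjI ballI)
  show "VectorSpace.subspace class_ring (mat_range A) (module_vec TYPE(complex) n)"
    by (rule mat_range_subspace[OF A])
  show "VectorSpace.subspace class_ring (mat_kernel (minkowski_adjoint A)) (module_vec TYPE(complex) n)"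
    by (rule mat_kernel_subspace[OF minkowski_adjoint_carrier[OF A]])
  have AM: "A * M \<in> carrier_mat n n" by (simp add: sq)
  show "mat_range A \<inter> mat_kernel (minkowski_adjoint A) = {0\<^sub>v n}"
  proof (intro equalityI subsetI)
    fix v assume "v \<in> mat_range A \<inter> mat_kernel (minkowski_adjoint A)"
    then obtain x where x: "x \<in> carrier_vec n" "v = A *\<^sub>v x" and "A * M *\<^sub>v v = 0\<^sub>v n"
      unfolding kernel_minkowski_adjoint mat_range_eq[OF A] mat_kernel[OF AM] by auto
    moreover have "A * M *\<^sub>v (A *\<^sub>v x) = A *\<^sub>v x"
      using assoc_mult_mat_vec[OF AM A x(1)] AMA by simp
    ultimately show "v \<in> {0\<^sub>v n}" by simp
  next
    fix v :: "complex vec" assume "v \<in> {0\<^sub>v n}"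
    moreover have "A *\<^sub>v 0\<^sub>v n = 0\<^sub>v n" "A * M *\<^sub>v 0\<^sub>v n = 0\<^sub>v n"
    using carrier_matD[OF A] carrier_matD[OF AM] by (auto intro!: eq_vecI simp: scalar_prod_def)
    ultimately show "v \<in> mat_range A \<inter> mat_kernel (minkowski_adjoint A)"
      unfolding kernel_minkowski_adjoint mat_range_eq[OF A] mat_kernel[OF AM]
      by (auto intro!: image_eqI[of _ _ "0\<^sub>v n"])
  qed
  fix v :: "complex vec" assume v: "v \<in> carrier_vec n"
  have Pv: "A * M *\<^sub>v v \<in> carrier_vec n" using AM v by simp
  have "A * M *\<^sub>v v = A *\<^sub>v (M *\<^sub>v v)" by (rule assoc_mult_mat_vec[OF A M v])
  then have 1: "A * M *\<^sub>v v \<in> mat_range A" unfolding mat_range_eq[OF A]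
    using mult_mat_vec_carrier[OF M v] by auto
  have "A * M *\<^sub>v (A * M *\<^sub>v v) = A * M *\<^sub>v v"
    using assoc_mult_mat_vec[OF AM AM v] by (simp add: sq rw)
  then have "A * M *\<^sub>v (v - A * M *\<^sub>v v) = 0\<^sub>v n"
    using mult_minus_distrib_mat_vec[OF AM v Pv] Pv by simp
  then have 2: "v - A * M *\<^sub>v v \<in> mat_kernel (minkowski_adjoint A)"
    unfolding kernel_minkowski_adjoint mat_kernel[OF AM] using v Pv by simp
  have "v = w + (v - w)" if "w \<in> carrier_vec n" for w using v that by auto
  from this[OF Pv] have "v = A * M *\<^sub>v v + (v - A * M *\<^sub>v v)" .
  then show "\<exists>s\<in>mat_range A. \<exists>t\<in>mat_kernel (minkowski_adjoint A). v = s + t" using 1 2 by blast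
qed

lemma projector_range_kernel:
  "projector n (mat_range A) (mat_kernel (minkowski_adjoint A)) = A * M"
proof (rule projector_eqI[OF direct_sum_range_kernel])
  have AM: "A * M \<in> carrier_mat n n" by (simp add: sq)
  show "mat_range A \<subseteq> carrier_vec n" unfolding mat_range_eq[OF A] using mult_mat_vec_carrier[OF A] by auto
  show "mat_kernel (minkowski_adjoint A) \<subseteq> carrier_vec n"
    unfolding kernel_minkowski_adjoint by (rule mat_kernel_carrier[OF AM])
  show "A * M \<in> carrier_mat n n" by fact
  show "\<forall>s \<in> mat_range A. A * M *\<^sub>v s = s"
    unfolding mat_range_eq[OF A] using assoc_mult_mat_vec[OF AM A] AMA by auto
  show "\<forall>t \<in> mat_kernel (minkowski_adjoint A). A * M *\<^sub>v t = 0\<^sub>v n"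
    unfolding kernel_minkowski_adjoint mat_kernel[OF AM] by simp
qed

lemma m_dmp_inverse_projector:
  "m_dmp_inverse A = D * projector n (mat_range A) (mat_kernel (minkowski_adjoint A))"
  unfolding m_dmp_inverse_eq projector_range_kernel by (simp add: sq)

lemma m_dmp_inverse_carrier [simp]: "m_dmp_inverse A \<in> carrier_mat n n"
  unfolding m_dmp_inverse_eq by (simp add: sq)

lemma m_dmp_inverse_square: "m_dmp_inverse A * m_dmp_inverse A = D * M"
  unfolding m_dmp_inverse_eq by (simp add: sq rw)

lemma m_dmp_inverse_pow_even: "m_dmp_inverse A ^\<^sub>m (2 * j) = (D * M) ^\<^sub>m j"
proof (induction j)
  case (Suc j)
  have "m_dmp_inverse A ^\<^sub>m (2 * Suc j)
      = m_dmp_inverse A ^\<^sub>m (2 * j) * (m_dmp_inverse A * m_dmp_inverse A)"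
    using sq(1)[of "m_dmp_inverse A ^\<^sub>m (2 * j)" "m_dmp_inverse A" "m_dmp_inverse A"] by simp
  then show ?case using Suc m_dmp_inverse_square by simp
qed (simp add: m_dmp_inverse_eq)

lemma m_dmp_inverse_pow_odd: "m_dmp_inverse A ^\<^sub>m (2 * j + 1) = A * (D * M) ^\<^sub>m (j + 1)"
proof -
  have DM: "D * M \<in> carrier_mat n n" by (simp add: sq)
  have eq: "m_dmp_inverse A = A * (D * M)" by (simp add: m_dmp_inverse_eq sq rw)
  have "m_dmp_inverse A ^\<^sub>m (2 * j + 1) = m_dmp_inverse A * m_dmp_inverse A ^\<^sub>m (2 * j)"
    using pow_mat_Suc_left[OF m_dmp_inverse_carrier, of "2 * j"] by simp
  also have "\<dots> = m_dmp_inverse A * (D * M) ^\<^sub>m j" unfolding m_dmp_inverse_pow_even ..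
  also have "\<dots> = A * (D * M) * (D * M) ^\<^sub>m j" unfolding eq ..
  also have "\<dots> = A * (D * M * (D * M) ^\<^sub>m j)"
    by (rule assoc_mult_mat[OF A DM pow_carrier_mat[OF DM]])
  also have "\<dots> = A * (D * M) ^\<^sub>m (j + 1)"
    using pow_mat_Suc_left[OF DM, of j] by simp
  finally show ?thesis .
qed

text \<open>
With \<open>B = A\<^sup>2 M\<close> one has \<open>B\<^sup>j\<^sup>+\<^sup>1 = A\<^sup>j\<^sup>+\<^sup>2 M\<close>, because \<open>M A\<close> is absorbed by an \<open>A\<close> on its left.  The
index of \<open>A\<close> plus one is therefore a sufficient exponent for \<open>B\<close>.
\<close>
lemma m_dmp_inverse_as_drazin: "m_dmp_inverse A = drazin_inverse (A ^\<^sub>m 2 * M)"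
proof -
  define B where "B = A * (A * M)"
  have B: "B \<in> carrier_mat n n" by (simp add: B_def sq)
  have pow: "B ^\<^sub>m (j + 1) = A ^\<^sub>m (j + 2) * M" for j
  proof (induction j)
    case (Suc j)
    have "B ^\<^sub>m (Suc j + 1) = A ^\<^sub>m (j + 2) * M * B" using Suc by simp
    also have "\<dots> = A ^\<^sub>m (Suc j + 2) * M" by (simp add: B_def sq rw)
    finally show ?case .
  qed (simp add: B_def sq numeral_2_eq_2)
  define k where "k = mat_index A"
  have "drazin_inverse B = D * (A * M)"
  proof (rule drazin_inverse_eqI[OF B, of _ "k + 1"])
    show "D * (A * M) * B * (D * (A * M)) = D * (A * M)"
      "B * (D * (A * M)) = D * (A * M) * B" by (simp_all add: B_def sq rw)
    have "B ^\<^sub>m (k + 1 + 1) * (D * (A * M)) = A ^\<^sub>m (k + 1 + 2) * (M * (D * (A * M)))"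
      unfolding pow by (simp add: sq)
    also have "\<dots> = A ^\<^sub>m (k + 2) * (A * (M * (D * (A * M))))" by (simp add: sq)
    also have "A * (M * (D * (A * M))) = D * (A * M)" by (simp add: sq rw)
    also have "A ^\<^sub>m (k + 2) * (D * (A * M)) = A ^\<^sub>m (k + 1) * (A * M)"
      using mult_mat_extend[OF pow_mult_drazin_inverse[OF A, of "k + 1"], of n n n "A * M" n]
      by (simp add: k_def sq)
    also have "\<dots> = B ^\<^sub>m (k + 1)" unfolding pow by (simp add: sq)
    finally show "B ^\<^sub>m (k + 1 + 1) * (D * (A * M)) = B ^\<^sub>m (k + 1)" .
  qed (simp add: sq)
  then show ?thesis by (simp add: m_dmp_inverse_eq B_def sq numeral_2_eq_2)
qed

lemma drazin_twice_m_dmp_inverse: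
  "drazin_inverse (drazin_inverse (m_dmp_inverse A)) = m_dmp_inverse A"
  unfolding m_dmp_inverse_as_drazin by (rule drazin_inverse_thrice[of _ n]) (simp add: sq)

lemma m_dmp_inverse_commute_iff:
  "A * m_dmp_inverse A = m_dmp_inverse A * A \<longleftrightarrow> m_dmp_inverse A = D"
proof
  assume "A * m_dmp_inverse A = m_dmp_inverse A * A"
  then have "D * (A * m_dmp_inverse A) = D * (m_dmp_inverse A * A)" by simp
  then show "m_dmp_inverse A = D" unfolding m_dmp_inverse_eq by (simp add: sq rw)
qed (simp add: rw)

text \<open>
The equation \<open>D A M = D\<close> says that \<open>D\<close> vanishes on the kernel of \<open>A M\<close>, which contains all
\<open>v - A M v\<close>.  The factorizations \<open>A\<^sup>k = A\<^sup>k\<^sup>+\<^sup>1 D\<close> and \<open>D = D\<^sup>k\<^sup>+\<^sup>1 A\<^sup>k\<close> exchange \<open>D\<close> for \<open>A\<^sup>k\<close>.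
\<close>
lemma m_dmp_inverse_eq_drazin_iff:
  "m_dmp_inverse A = D \<longleftrightarrow> mat_kernel (minkowski_adjoint A) \<subseteq> mat_kernel (A ^\<^sub>m mat_index A)"
proof -
  define k where "k = mat_index A"
  have AM: "A * M \<in> carrier_mat n n" by (simp add: sq)
  have Ak: "A ^\<^sub>m k \<in> carrier_mat n n" by simp
  have "m_dmp_inverse A = D \<longleftrightarrow> mat_kernel (A * M) \<subseteq> mat_kernel (A ^\<^sub>m k)"
  proof
    assume X: "m_dmp_inverse A = D"
    have "A ^\<^sub>m k = A ^\<^sub>m (k + 1) * m_dmp_inverse A"
      unfolding X using pow_mult_drazin_inverse[OF A, of k] by (simp add: k_def)
    also have "\<dots> = (A ^\<^sub>m (k + 1) * D) * (A * M)" by (simp add: m_dmp_inverse_eq sq)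
    finally show "mat_kernel (A * M) \<subseteq> mat_kernel (A ^\<^sub>m k)"
      using mat_kernel_mult_subset[OF AM, of "A ^\<^sub>m (k + 1) * D" n] by (simp add: sq)
  next
    assume sub: "mat_kernel (A * M) \<subseteq> mat_kernel (A ^\<^sub>m k)"
    have "A ^\<^sub>m k = A ^\<^sub>m k * (A * M)"
    proof (rule mat_eq_if_mult_vec_eq[OF Ak])
      fix v :: "complex vec" assume v: "v \<in> carrier_vec n"
      have Pv: "A * M *\<^sub>v v \<in> carrier_vec n" using AM v by simp
      have "A * M *\<^sub>v (A * M *\<^sub>v v) = A * M *\<^sub>v v"
        using assoc_mult_mat_vec[OF AM AM v] by (simp add: sq rw)
      then have "v - A * M *\<^sub>v v \<in> mat_kernel (A * M)"
        using mult_minus_distrib_mat_vec[OF AM v Pv] Pv v by (simp add: mat_kernel[OF AM])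
      then have "A ^\<^sub>m k *\<^sub>v (v - A * M *\<^sub>v v) = 0\<^sub>v n" using sub mat_kernel[OF Ak] by blast
      then have "A ^\<^sub>m k *\<^sub>v v - A ^\<^sub>m k *\<^sub>v (A * M *\<^sub>v v) = 0\<^sub>v n"
        using mult_minus_distrib_mat_vec[OF Ak v Pv] by simp
      moreover have "A ^\<^sub>m k *\<^sub>v v \<in> carrier_vec n" "A ^\<^sub>m k *\<^sub>v (A * M *\<^sub>v v) \<in> carrier_vec n"
        using mult_mat_vec_carrier[OF Ak] v Pv by auto
      ultimately have "A ^\<^sub>m k *\<^sub>v v = A ^\<^sub>m k *\<^sub>v (A * M *\<^sub>v v)"
        by (intro eq_vecI) (metis carrier_vecD eq_iff_diff_eq_0 index_minus_vec(1) index_zero_vec(1), simp)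
      then show "A ^\<^sub>m k *\<^sub>v v = A ^\<^sub>m k * (A * M) *\<^sub>v v"
        using assoc_mult_mat_vec[OF Ak AM v] by simp
    qed (simp add: sq)
    then have "D ^\<^sub>m (k + 1) * A ^\<^sub>m k = D ^\<^sub>m (k + 1) * A ^\<^sub>m k * (A * M)"
      using sq(1)[of "D ^\<^sub>m (k + 1)" "A ^\<^sub>m k" "A * M"] AM by (metis A drazin_inverse_carrier pow_carrier_mat)
    then show "m_dmp_inverse A = D"
      unfolding drazin_inverse_pow_mult_pow[OF A] m_dmp_inverse_eq by (simp add: sq)
  qed
  then show ?thesis unfolding kernel_minkowski_adjoint k_def .
qed

lemma m_dmp_inverse_zero_iff: "m_dmp_inverse A = 0\<^sub>m n n \<longleftrightarrow> nilpotent_mat A"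
proof
  assume X: "m_dmp_inverse A = 0\<^sub>m n n"
  have "D = m_dmp_inverse A * A * D" by (simp add: m_dmp_inverse_eq sq rw)
  then have "D = 0\<^sub>m n n"
    unfolding X left_mult_zero_mat[OF A] left_mult_zero_mat[OF drazin_inverse_carrier[OF A]] .
  then have "A ^\<^sub>m mat_index A = 0\<^sub>m n n"
    using pow_mult_drazin_inverse[OF A order_refl]
      right_mult_zero_mat[OF pow_carrier_mat[OF A, of "mat_index A + 1"]] by simp
  then show "nilpotent_mat A" using carrier_matD(1)[OF A] by (auto simp: nilpotent_mat_def)
next
  assume "nilpotent_mat A"
  then obtain m where "A ^\<^sub>m m = 0\<^sub>m n n" using A by (auto simp: nilpotent_mat_def)
  then have "D = 0\<^sub>m n n"
    using drazin_inverse_pow_mult_pow[OF A, of m]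
      right_mult_zero_mat[OF pow_carrier_mat[OF drazin_inverse_carrier[OF A], of "m + 1"]] by simp
  then show "m_dmp_inverse A = 0\<^sub>m n n"
    unfolding m_dmp_inverse_eq by (simp add: left_mult_zero_mat[OF A] left_mult_zero_mat[OF M])
qed

end

text \<open>
By Cline's formula \<open>D = F E\<^sup>2 H\<close> with \<open>E\<close> the Drazin inverse of \<open>T = H F\<close>, so \<open>D F = F E\<^sup>2 T = F E\<close>.
\<close>
lemma (in minkowski_invertible) m_dmp_inverse_of_factorization:
  fixes r :: nat and F H B :: "complex mat"
  assumes F: "F \<in> carrier_mat n r" and H: "H \<in> carrier_mat r n" and AFH: "A = F * H"
    and B: "B \<in> carrier_mat r r" and AM: "A * M = F * B * mat_adjoint F * minkowski_metric n"
  shows "m_dmp_inverse A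
    = F * (drazin_inverse (H * F) * (B * (mat_adjoint F * minkowski_metric n)))"
proof -
  define T where "T = H * F"
  define E where "E = drazin_inverse T"
  have T: "T \<in> carrier_mat r r" using F H by (simp add: T_def)
  then have E: "E \<in> carrier_mat r r" by (simp add: E_def)
  note dims = carrier_matD[OF F] carrier_matD[OF H] carrier_matD[OF T] carrier_matD[OF E] carrier_matD[OF B]
  have HF: "H * F = T" by (simp add: T_def)
  have D: "D = F * (E * (E * H))"
    unfolding AFH drazin_inverse_mult_swap[OF F H] by (simp add: HF mult_mat_assoc dims flip: E_def)
  have "E * (E * T) = E"
    using drazin_inverse_rewrites[OF T, folded E_def] T E by simp
  then have "D * F = F * E"
    by (simp add: D mult_mat_assoc dims HF)
  note DF = mult_mat_rewrite[OF this]
  have "m_dmp_inverse A = D * (A * M)" unfolding m_dmp_inverse_eq by (simp add: sq)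
  also have "\<dots> = F * (E * (B * (mat_adjoint F * minkowski_metric n)))"
    unfolding AM using carrier_matD[OF drazin_inverse_carrier[OF A]] by (simp add: mult_mat_assoc dims DF)
  finally show ?thesis by (simp add: E_def T_def)
qed

section \<open>The Hartwig--Spindelboeck blocks\<close>

text \<open>
The matrix with the two blocks \<open>P\<close> and \<open>Q\<close> side by side, written as a four-block matrix with two
blocks of height zero, so that the multiplication rule for four-block matrices applies.
\<close>
definition row_block :: "'a :: zero mat \<Rightarrow> 'a mat \<Rightarrow> 'a mat" where
  "row_block P Q = four_block_mat P Q (0\<^sub>m 0 (dim_col P)) (0\<^sub>m 0 (dim_col Q))"

text \<open>
The first \<open>r\<close> columns of the unit matrix of order \<open>r + m\<close>.
\<close>
definition unit_col_block :: "nat \<Rightarrow> nat \<Rightarrow> 'a :: {zero,one} mat" where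
  "unit_col_block r m = four_block_mat (1\<^sub>m r) (0\<^sub>m r 0) (0\<^sub>m m r) (0\<^sub>m m 0)"

lemma row_block_carrier [simp]:
  assumes "P \<in> carrier_mat r p" "Q \<in> carrier_mat r q"
  shows "row_block P Q \<in> carrier_mat r (p + q)"
  using four_block_carrier_mat[of P r p "0\<^sub>m 0 (dim_col Q)" 0 q] assms by (simp add: row_block_def)

lemma unit_col_block_carrier [simp]: "unit_col_block r m \<in> carrier_mat (r + m) r"
  using four_block_carrier_mat[of "1\<^sub>m r" r r "0\<^sub>m m 0" m 0] by (simp add: unit_col_block_def)

lemma row_block_inject:
  assumes "P \<in> carrier_mat r p" "Q \<in> carrier_mat r q" "P' \<in> carrier_mat r p" "Q' \<in> carrier_mat r q"
  shows "row_block P Q = row_block P' Q' \<longleftrightarrow> P = P' \<and> Q = Q'"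
proof
  assume eq: "row_block P Q = row_block P' Q'"
  have entry: "row_block P Q $$ (i, j) = row_block P' Q' $$ (i, j)" for i j using eq by simp
  have "P = P'"
  proof (rule eq_matI)
    fix i j assume "i < dim_row P'" "j < dim_col P'"
    then show "P $$ (i, j) = P' $$ (i, j)"
      using entry[of i j] assms by (auto simp: row_block_def)
  qed (use assms in auto)
  moreover have "Q = Q'"
  proof (rule eq_matI)
    fix i j assume "i < dim_row Q'" "j < dim_col Q'"
    then show "Q $$ (i, j) = Q' $$ (i, j)"
      using entry[of i "p + j"] assms by (auto simp: row_block_def)
  qed (use assms in auto)
  ultimately show "P = P' \<and> Q = Q'" ..
qed simp

lemma four_block_mat_empty:
  assumes "P \<in> carrier_mat r r" "D \<in> carrier_mat 0 0"
  shows "four_block_mat P B C D = P"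
  by (rule eq_matI) (use assms in auto)

lemma row_block_mult_unit:
  fixes P Q :: "complex mat"
  assumes "P \<in> carrier_mat r r" "Q \<in> carrier_mat r m"
  shows "row_block P Q * unit_col_block r m = P"
  unfolding row_block_def unit_col_block_def
  by (subst mult_four_block_mat[of _ r r _ m _ 0])
    (use assms in \<open>auto intro!: four_block_mat_empty\<close>)

lemma unit_mult_row_block:
  fixes P Q :: "complex mat"
  assumes "P \<in> carrier_mat r p" "Q \<in> carrier_mat r q"
  shows "unit_col_block r m * row_block P Q = four_block_mat P Q (0\<^sub>m m p) (0\<^sub>m m q)"
  unfolding row_block_def unit_col_block_def
  by (subst mult_four_block_mat[of _ r r _ 0 _ m]) (use assms in auto)

lemma mat_adjoint_zero [simp]: "mat_adjoint (0\<^sub>m p q :: complex mat) = 0\<^sub>m q p"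
  by (rule eq_matI) (auto simp: mat_adjoint_index)

lemma mat_adjoint_unit_col_block:
  "mat_adjoint (unit_col_block r m :: complex mat) = row_block (1\<^sub>m r) (0\<^sub>m r m)"
  unfolding row_block_def unit_col_block_def
  by (subst mat_adjoint_four_block[of _ r r _ 0 _ m]) auto

lemma row_block_mult_four_block:
  fixes P Q :: "complex mat"
  assumes "P \<in> carrier_mat r r" "Q \<in> carrier_mat r m" "A1 \<in> carrier_mat r p" "A2 \<in> carrier_mat r q"
    "A3 \<in> carrier_mat m p" "A4 \<in> carrier_mat m q"
  shows "row_block P Q * four_block_mat A1 A2 A3 A4 = row_block (P * A1 + Q * A3) (P * A2 + Q * A4)"
  unfolding row_block_def
  by (subst mult_four_block_mat[of _ r r _ m _ 0]) (use assms in auto)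

lemma mult_row_block:
  fixes P Q X :: "complex mat"
  assumes "X \<in> carrier_mat r r" "P \<in> carrier_mat r p" "Q \<in> carrier_mat r q"
  shows "X * row_block P Q = row_block (X * P) (X * Q)"
proof -
  have X: "X = four_block_mat X (0\<^sub>m r 0) (0\<^sub>m 0 r) (0\<^sub>m 0 0)"
    using four_block_mat_empty[OF assms(1)] by simp
  show ?thesis
    unfolding row_block_def
    by (subst X, subst mult_four_block_mat[of _ r r _ 0 _ 0]) (use assms in auto)
qed

lemma row_block_mult_adjoint:
  fixes P Q :: "complex mat"
  assumes "P \<in> carrier_mat r p" "Q \<in> carrier_mat r q"
  shows "row_block P Q * mat_adjoint (row_block P Q) = P * mat_adjoint P + Q * mat_adjoint Q"
  unfolding row_block_def
  by (subst mat_adjoint_four_block[of _ r p _ q _ 0], use assms in auto,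
      subst mult_four_block_mat[of _ r p _ q _ 0 _ _ r _ 0])
    (use assms in \<open>auto intro!: four_block_mat_empty\<close>)

lemma mat_inverse_eqI:
  fixes X :: "'a :: field mat"
  assumes X: "X \<in> carrier_mat m m" and Y: "Y \<in> carrier_mat m m" and XY: "X * Y = 1\<^sub>m m"
    and YX: "Y * X = 1\<^sub>m m"
  shows "mat_inverse X = Some Y"
proof (cases "mat_inverse X")
  case None
  have "X \<in> Units (ring_mat TYPE('a) m ())"
    using X Y XY YX unfolding Units_def ring_mat_def by auto
  then show ?thesis using mat_inverse(1)[OF X None, of "()"] by simp
next
  case (Some Z)
  then have Z: "X * Z = 1\<^sub>m m" "Z \<in> carrier_mat m m" using mat_inverse(2)[OF X] by auto
  have "Z = Y * X * Z" using YX Z(2) by simp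
  also have "\<dots> = Y" using Z assoc_mult_mat[OF Y X Z(2)] Y by simp
  finally show ?thesis using Some by simp
qed

lemma mat_diag_positive_inverse:
  assumes "\<And>i. i < r \<Longrightarrow> \<sigma> i > (0::real)"
  shows "mat_diag r (\<lambda>i. complex_of_real (1 / \<sigma> i)) * mat_diag r (\<lambda>i. complex_of_real (\<sigma> i)) = 1\<^sub>m r"
  unfolding mat_diag_diag by (rule eq_matI) (use assms in \<open>force simp: mat_diag_def\<close>)+

theorem theorem3p11:
  fixes A U K L G1 G2 G4 :: "complex mat" and \<sigma> :: "nat \<Rightarrow> real" and n k r :: nat
  defines "S \<equiv> mat_diag r (\<lambda>i. complex_of_real (\<sigma> i))"
  assumes "n \<ge> 1"
    and "A \<in> carrier_mat n n"
    and "mat_index A = k"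
    and "mat_rank A = r"
    and "mat_rank (minkowski_adjoint A * A * minkowski_adjoint A) = mat_rank A"
    and "unitary_mat n U"
    and "\<And>i. i < r \<Longrightarrow> \<sigma> i > 0"
    and "image_mset \<sigma> (mset_set {..<r}) = filter_mset (\<lambda>s. s > 0) (singular_values A)"
    and "K \<in> carrier_mat r r"
    and "L \<in> carrier_mat r (n - r)"
    and "K * mat_adjoint K + L * mat_adjoint L = 1\<^sub>m r"
    and "A = U * four_block_mat (S * K) (S * L) (0\<^sub>m (n - r) r) (0\<^sub>m (n - r) (n - r))
               * mat_adjoint U"
    and "G1 \<in> carrier_mat r r"
    and "G2 \<in> carrier_mat r (n - r)"
    and "G4 \<in> carrier_mat (n - r) (n - r)"
    and "minkowski_metric n = U * four_block_mat G1 G2 (mat_adjoint G2) G4 * mat_adjoint U"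
  shows
    \<comment> \<open>The notations used below are meaningful.\<close>
    "((\<exists>!X. is_minkowski_inverse A X) \<and>
      direct_sum_vec n (mat_range A) (mat_kernel (minkowski_adjoint A)) \<and>
      invertible_mat G1) \<and>
     \<comment> \<open>(1)\<close>
     m_dmp_inverse A
       = drazin_inverse A * projector n (mat_range A) (mat_kernel (minkowski_adjoint A)) \<and>
     \<comment> \<open>(2)\<close>
     (\<forall>l::nat. l > 0 \<longrightarrow>
        (even l \<longrightarrow>
           m_dmp_inverse A ^\<^sub>m l
             = (drazin_inverse A * minkowski_inverse A) ^\<^sub>m (l div 2)) \<and>
        (odd l \<longrightarrow>
           m_dmp_inverse A ^\<^sub>m l
             = A * (drazin_inverse A * minkowski_inverse A) ^\<^sub>m ((l + 1) div 2))) \<and>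
     \<comment> \<open>(3)\<close>
     m_dmp_inverse A = drazin_inverse (A ^\<^sub>m 2 * minkowski_inverse A) \<and>
     \<comment> \<open>(4)\<close>
     drazin_inverse (drazin_inverse (m_dmp_inverse A)) = m_dmp_inverse A \<and>
     \<comment> \<open>(5)\<close>
     (A * m_dmp_inverse A = m_dmp_inverse A * A \<longleftrightarrow> m_dmp_inverse A = drazin_inverse A) \<and>
     (m_dmp_inverse A = drazin_inverse A \<longleftrightarrow>
        mat_kernel (minkowski_adjoint A) \<subseteq> mat_kernel (A ^\<^sub>m k)) \<and>
     \<comment> \<open>(6)\<close>
     (m_dmp_inverse A = 0\<^sub>m n n \<longleftrightarrow> nilpotent_mat A) \<and>
     \<comment> \<open>(7)\<close>
     (m_dmp_inverse A = A \<longleftrightarrow>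
        drazin_inverse (S * K) = S * K \<and> L = K * the (mat_inverse G1) * G2)"
proof -
  define m where "m = n - r"
  note A = assms(3) and index = assms(4) and rank_A = assms(5) and rank_hyp = assms(6) and U_hyp = assms(7)
    and \<sigma> = assms(8) and K = assms(10) and L = assms(11)[folded m_def] and KL = assms(12)
    and A_blocks = assms(13)[folded m_def] and G1 = assms(14) and G2 = assms(15)[folded m_def]
    and G4 = assms(16)[folded m_def] and G_blocks = assms(17)
  define G where "G = minkowski_metric n"
  have "r \<le> n" using vec_space.rank_le_nc[OF A] rank_A A by simp
  then have n: "r + m = n" by (simp add: m_def)
  have U: "U \<in> carrier_mat n n" "mat_adjoint U * U = 1\<^sub>m n" "U * mat_adjoint U = 1\<^sub>m n"
    using U_hyp by (auto simp: unitary_mat_def)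
  define U' where "U' = mat_adjoint U"
  have U': "U' \<in> carrier_mat n n" using U by (simp add: U'_def)
  have G: "G \<in> carrier_mat n n" by (simp add: G_def)
  have S: "S \<in> carrier_mat r r" by (simp add: S_def)
  define S' where "S' = mat_diag r (\<lambda>i. complex_of_real (1 / \<sigma> i))"
  have S': "S' \<in> carrier_mat r r" by (simp add: S'_def)
  have S'S: "S' * S = 1\<^sub>m r" unfolding S'_def S_def by (rule mat_diag_positive_inverse[OF \<sigma>])
  have S_adj: "mat_adjoint S = S" by (rule eq_matI) (auto simp: S_def mat_adjoint_index mat_diag_def)
  define T where "T = S * K"
  define V where "V = S * L"
  have T: "T \<in> carrier_mat r r" and V: "V \<in> carrier_mat r m" using S K L by (auto simp: T_def V_def)
  define J :: "complex mat" where "J = unit_col_block r m"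
  have J: "J \<in> carrier_mat n r" using unit_col_block_carrier[of r m] by (simp add: J_def n)
  have TV: "row_block T V \<in> carrier_mat r n" and G12: "row_block G1 G2 \<in> carrier_mat r n"
    using row_block_carrier[OF T V] row_block_carrier[OF G1 G2] by (simp_all add: n)
  \<comment> \<open>The full rank factorization of A read off from the blocks.\<close>
  define F where "F = U * J"
  define H where "H = row_block T V * U'"
  have F: "F \<in> carrier_mat n r" and H: "H \<in> carrier_mat r n" using U J TV U' by (auto simp: F_def H_def)
  note dims = carrier_matD[OF U(1)] carrier_matD[OF U'] carrier_matD[OF G] carrier_matD[OF S] carrier_matD[OF S']
    carrier_matD[OF K] carrier_matD[OF L] carrier_matD[OF T] carrier_matD[OF V] carrier_matD[OF J]
    carrier_matD[OF TV] carrier_matD[OF G12] carrier_matD[OF F] carrier_matD[OF H] carrier_matD[OF G1] carrier_matD[OF G2]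
  have U'U: "U' * (U * Z) = Z" if "dim_row Z = n" for Z
    using mult_mat_rewrite[OF U(2)[folded U'_def], of Z] that by (simp add: dims)
  have S'SZ: "S' * (S * Z) = Z" if "dim_row Z = r" for Z
    using mult_mat_rewrite[OF S'S, of Z] that by (simp add: dims)
  have JJ: "mat_adjoint J * J = 1\<^sub>m r"
    unfolding J_def mat_adjoint_unit_col_block by (rule row_block_mult_unit) auto
  have AFH: "A = F * H"
    unfolding A_blocks F_def H_def
    by (simp add: mult_mat_assoc dims unit_mult_row_block[OF T V, of m, symmetric]
        flip: J_def U'_def T_def V_def)
  have F_adj: "mat_adjoint F = mat_adjoint J * U'"
    by (simp add: F_def mat_adjoint_mult_dim dims U'_def)
  have FF: "mat_adjoint F * F = 1\<^sub>m r"
    unfolding F_adj by (simp add: F_def mult_mat_assoc dims U'U JJ)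
  have FG: "mat_adjoint F * G = row_block G1 G2 * U'"
  proof -
    define Gb where "Gb = four_block_mat G1 G2 (mat_adjoint G2) G4"
    have Gb: "Gb \<in> carrier_mat n n" using four_block_carrier_mat[OF G1 G4] by (simp add: Gb_def n)
    have "mat_adjoint J * Gb = row_block G1 G2"
      unfolding J_def mat_adjoint_unit_col_block Gb_def
      by (subst row_block_mult_four_block[of _ r _ m _ r _ m]) (use G1 G2 G4 in auto)
    moreover have "mat_adjoint F * G = mat_adjoint J * Gb * U'"
      unfolding F_adj G_def G_blocks Gb_def[symmetric]
      by (simp add: mult_mat_assoc dims U'U carrier_matD[OF Gb] flip: U'_def)
    ultimately show ?thesis by simp
  qed
  have FGF: "mat_adjoint F * G * F = G1"
    unfolding FG by (simp add: F_def mult_mat_assoc dims U'U)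
      (simp add: J_def row_block_mult_unit[OF G1 G2])
  have HF: "H * F = T"
    by (simp add: H_def F_def mult_mat_assoc dims U'U) (simp add: J_def row_block_mult_unit[OF T V])
  have HH: "H * mat_adjoint H = S * S"
  proof -
    have "H * mat_adjoint H = row_block T V * mat_adjoint (row_block T V)"
      by (simp add: H_def mat_adjoint_mult_dim dims mult_mat_assoc U'U U'_def[symmetric])
        (simp add: U'_def U'U[unfolded U'_def] dims)
    also have "\<dots> = T * mat_adjoint T + V * mat_adjoint V"
      by (rule row_block_mult_adjoint[OF T V])
    also have "\<dots> = S * (K * mat_adjoint K * S) + S * (L * mat_adjoint L * S)"
      by (simp add: T_def V_def mat_adjoint_mult_dim dims mult_mat_assoc S_adj)
    also have "\<dots> = S * (K * mat_adjoint K * S + L * mat_adjoint L * S)"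
      by (rule mult_add_distrib_mat[symmetric, OF S]) (use K L S in auto)
    also have "\<dots> = S * ((K * mat_adjoint K + L * mat_adjoint L) * S)"
      by (subst add_mult_distrib_mat[of _ r r _ _ r]) (use K L S in auto)
    finally show ?thesis using KL S by simp
  qed
  \<comment> \<open>Invertibility of the Gram matrix is what makes the adjoint of H cancellable.\<close>
  have C: "S' * S' * (H * mat_adjoint H) = 1\<^sub>m r"
    unfolding HH by (simp add: mult_mat_assoc dims S'SZ S'S)
  obtain B M where B: "B \<in> carrier_mat r r" and G1B: "G1 * B = 1\<^sub>m r" and BG1: "B * G1 = 1\<^sub>m r"
    and M_inv: "is_minkowski_inverse A M" and AM: "A * M = F * B * mat_adjoint F * G"
    using minkowski_inverse_of_full_rank_factorization[OF F H AFH _ C rank_A rank_hyp] S'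
    unfolding FGF[unfolded G_def] G_def by auto
  interpret minkowski_invertible n A M by unfold_locales (fact A, fact M_inv)
  have ex1: "\<exists>!X. is_minkowski_inverse A X"
    using M_inv is_minkowski_inverse_unique[OF A] by blast
  have inv_G1: "invertible_mat G1"
    unfolding invertible_mat_def inverts_mat_def using G1 B G1B BG1 by auto
  have mat_inv: "the (mat_inverse G1) = B" using mat_inverse_eqI[OF G1 B G1B BG1] by simp
  define E where "E = drazin_inverse T"
  have E: "E \<in> carrier_mat r r" using T by (simp add: E_def)
  have eq7: "m_dmp_inverse A = A \<longleftrightarrow> E = T \<and> L = K * B * G2"
  proof -
    \<comment> \<open>The nonzero block row of the m-DMP inverse in the basis U is (E, W).\<close>
    define W where "W = E * (B * G2)"
    have W: "W \<in> carrier_mat r m" using E B G2 by (auto simp: W_def)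
    have EW: "row_block E W \<in> carrier_mat r n" using row_block_carrier[OF E W] by (simp add: n)
    note dims = dims carrier_matD[OF B] carrier_matD[OF E] carrier_matD[OF W] carrier_matD[OF EW]
    have "E * (B * row_block G1 G2) = row_block E W"
      using mult_row_block[OF B G1 G2] mult_row_block[of E r "1\<^sub>m r" r "B * G2" m] E B G2 BG1
      by (simp add: W_def)
    then have X: "m_dmp_inverse A = F * (row_block E W * U')"
      using m_dmp_inverse_of_factorization[OF F H AFH B AM[unfolded G_def]]
      unfolding HF G_def[symmetric] FG E_def[symmetric]
      by (simp add: dims flip: mult_mat_assoc)
    have "m_dmp_inverse A = A \<longleftrightarrow> row_block E W = row_block T V"
    proof
      assume "m_dmp_inverse A = A"
      then have "mat_adjoint F * (F * (row_block E W * U')) * U = mat_adjoint F * (F * (row_block T V * U')) * U"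
        unfolding X[symmetric] by (simp add: AFH H_def)
      moreover have "mat_adjoint F * (F * (Z * U')) * U = Z" if "Z \<in> carrier_mat r n" for Z
        using mult_mat_rewrite[OF FF, of "Z * (U' * U)"] that U(2)[folded U'_def]
        by (simp add: mult_mat_assoc dims)
      ultimately show "row_block E W = row_block T V" using EW TV by simp
    next
      assume "row_block E W = row_block T V"
      then show "m_dmp_inverse A = A" unfolding X by (simp add: AFH H_def)
    qed
    also have "\<dots> \<longleftrightarrow> E = T \<and> W = V" by (rule row_block_inject[OF E W T V])
    also have "\<dots> \<longleftrightarrow> E = T \<and> L = K * B * G2"
    proof (rule conj_cong[OF refl])
      assume "E = T"
      then have W': "W = S * (K * B * G2)" by (simp add: W_def T_def mult_mat_assoc dims)
      have "S' * W = K * B * G2" "S' * V = L"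
        unfolding W' V_def by (simp_all add: S'SZ dims)
      then show "W = V \<longleftrightarrow> L = K * B * G2" using W' V_def by metis
    qed
    finally show ?thesis .
  qed
  show ?thesis
  proof (intro conjI allI impI)
    show "\<exists>!X. is_minkowski_inverse A X" by fact
    show "direct_sum_vec n (mat_range A) (mat_kernel (minkowski_adjoint A))"
      by (rule direct_sum_range_kernel)
    show "invertible_mat G1" by fact
    show "m_dmp_inverse A
       = drazin_inverse A * projector n (mat_range A) (mat_kernel (minkowski_adjoint A))"
      by (rule m_dmp_inverse_projector)
    show "m_dmp_inverse A ^\<^sub>m l = (drazin_inverse A * minkowski_inverse A) ^\<^sub>m (l div 2)"
      if "even l" for l
      using m_dmp_inverse_pow_even[of "l div 2"] that by (simp add: minkowski_inverse_eq)
    show "m_dmp_inverse A ^\<^sub>m l = A * (drazin_inverse A * minkowski_inverse A) ^\<^sub>m ((l + 1) div 2)"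
      if "odd l" for l
    proof -
      obtain j where l: "l = 2 * j + 1" using \<open>odd l\<close> by (rule oddE)
      show ?thesis using m_dmp_inverse_pow_odd[of j] by (simp add: l minkowski_inverse_eq del: pow_mat.simps)
    qed
    show "m_dmp_inverse A = drazin_inverse (A ^\<^sub>m 2 * minkowski_inverse A)"
      using m_dmp_inverse_as_drazin by (simp add: minkowski_inverse_eq)
    show "drazin_inverse (drazin_inverse (m_dmp_inverse A)) = m_dmp_inverse A"
      by (rule drazin_twice_m_dmp_inverse)
    show "A * m_dmp_inverse A = m_dmp_inverse A * A \<longleftrightarrow> m_dmp_inverse A = drazin_inverse A"
      by (rule m_dmp_inverse_commute_iff)
    show "m_dmp_inverse A = drazin_inverse A \<longleftrightarrow> mat_kernel (minkowski_adjoint A) \<subseteq> mat_kernel (A ^\<^sub>m k)"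
      using m_dmp_inverse_eq_drazin_iff by (simp add: index)
    show "m_dmp_inverse A = 0\<^sub>m n n \<longleftrightarrow> nilpotent_mat A"
      by (rule m_dmp_inverse_zero_iff)
    show "m_dmp_inverse A = A \<longleftrightarrow>
        drazin_inverse (S * K) = S * K \<and> L = K * the (mat_inverse G1) * G2"
      using eq7 by (simp add: E_def T_def mat_inv)
  qed
qed

end
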